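(* Let $\mathcal M=(M,<,+,0,\ldots)$ be a definably complete locally o-minimal expansion of an ordered abelian group. Let $C\subseteq M^m$ be a definable closed set and $P\subseteq M^n$ a nonempty definable set, and let $\pi:C\times P\to P$ be the projection. Let $f:C\times P\to M$ be a definable function which is equi-continuous with respect to $P$, and let $D=\{(x,q)\in C\times P : f \text{ is discontinuous at } (x,q)\}$. Then $\dim \pi(D)<\dim P$.
   Context: "Definable" means definable with parameters. Definably complete: every definable subset of $M$ has a supremum and infimum in $M\cup\{\pm\infty\}$. Locally o-minimal: for every definable $X\subseteq M$ and $a\in M$ there is an open interval $I\ni a$ with $X\cap I$ a finite union of points and open intervals. $|x|=\max_i|x_i|$ on $M^k$; $C\times P$ has the subspace topology of the product order topology. $f$ is equi-continuous with respect to $P$ if for all $\varepsilon>0$ and $x\in C$ there is $\delta>0$ such that for all $p\in P$ and $x'\in C$ with $|x-x'|<\delta$, $|f(x,p)-f(x',p)|<\varepsilon$. The dimension of a nonempty definable $X\subseteq M^n$ is the maximal $d$ such that $\rho(X)$ has nonempty interior for some coordinate projection $\rho:M^n\to M^d$ ($M^0$ a point); $\dim\emptyset=-\infty$. *)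

theory Defs
  imports Main
begin

datatype 'f tm = Var nat | Zero | Plus "'f tm" "'f tm" | Fn 'f "'f tm list"

datatype ('f, 'r) fm =
    Eq "'f tm" "'f tm" | Less "'f tm" "'f tm" | Rel 'r "'f tm list"
  | Not "('f, 'r) fm" | And "('f, 'r) fm" "('f, 'r) fm" | Ex nat "('f, 'r) fm"

fun tm_eval :: "('f \<Rightarrow> 'a::linordered_ab_group_add list \<Rightarrow> 'a) \<Rightarrow> (nat \<Rightarrow> 'a) \<Rightarrow> 'f tm \<Rightarrow> 'a" where
  "tm_eval F e (Var i) = e i"
| "tm_eval F e Zero = 0"
| "tm_eval F e (Plus s t) = tm_eval F e s + tm_eval F e t"
| "tm_eval F e (Fn g ts) = F g (map (tm_eval F e) ts)"

fun sat :: "('f \<Rightarrow> 'a::linordered_ab_group_add list \<Rightarrow> 'a) \<Rightarrow> ('r \<Rightarrow> 'a list \<Rightarrow> bool) \<Rightarrow> (nat \<Rightarrow> 'a) \<Rightarrow> ('f, 'r) fm \<Rightarrow> bool" where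
  "sat F R e (Eq s t) = (tm_eval F e s = tm_eval F e t)"
| "sat F R e (Less s t) = (tm_eval F e s < tm_eval F e t)"
| "sat F R e (Rel r ts) = R r (map (tm_eval F e) ts)"
| "sat F R e (Not \<phi>) = (\<not> sat F R e \<phi>)"
| "sat F R e (And \<phi> \<psi>) = (sat F R e \<phi> \<and> sat F R e \<psi>)"
| "sat F R e (Ex v \<phi>) = (\<exists>a. sat F R (e(v := a)) \<phi>)"

text \<open>Elements of M^k are lists of length k. A set X \<subseteq> M^k is definable (with
  parameters) if it is defined by a formula whose variables 0..k-1 are the
  coordinates and all other variables are assigned fixed parameters.\<close>

definition definable :: "('f \<Rightarrow> 'a::linordered_ab_group_add list \<Rightarrow> 'a) \<Rightarrow> ('r \<Rightarrow> 'a list \<Rightarrow> bool) \<Rightarrow> nat \<Rightarrow> 'a list set \<Rightarrow> bool" where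
  "definable F R k X \<longleftrightarrow>
     (\<exists>(\<phi> :: ('f, 'r) fm) (e :: nat \<Rightarrow> 'a).
        X = {xs. length xs = k \<and> sat F R (\<lambda>i. if i < k then xs ! i else e i) \<phi>})"

definition definable1 :: "('f \<Rightarrow> 'a::linordered_ab_group_add list \<Rightarrow> 'a) \<Rightarrow> ('r \<Rightarrow> 'a list \<Rightarrow> bool) \<Rightarrow> 'a set \<Rightarrow> bool" where
  "definable1 F R S \<longleftrightarrow> definable F R 1 ((\<lambda>x. [x]) ` S)"

definition definably_complete :: "('f \<Rightarrow> 'a::linordered_ab_group_add list \<Rightarrow> 'a) \<Rightarrow> ('r \<Rightarrow> 'a list \<Rightarrow> bool) \<Rightarrow> bool" where
  "definably_complete F R \<longleftrightarrow>
     (\<forall>S :: 'a set. definable1 F R S \<longrightarrow> S \<noteq> {} \<longrightarrow>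
        ((\<exists>b. \<forall>x\<in>S. x \<le> b) \<longrightarrow> (\<exists>s. (\<forall>x\<in>S. x \<le> s) \<and> (\<forall>b. (\<forall>x\<in>S. x \<le> b) \<longrightarrow> s \<le> b))) \<and>
        ((\<exists>b. \<forall>x\<in>S. b \<le> x) \<longrightarrow> (\<exists>s. (\<forall>x\<in>S. s \<le> x) \<and> (\<forall>b. (\<forall>x\<in>S. b \<le> x) \<longrightarrow> b \<le> s))))"

definition finite_union_points_intervals :: "'a::linorder set \<Rightarrow> bool" where
  "finite_union_points_intervals S \<longleftrightarrow>
     (\<exists>F I. finite F \<and> finite I \<and> S = F \<union> (\<Union>(a, b)\<in>I. {a<..<b}))"

definition locally_o_minimal :: "('f \<Rightarrow> 'a::linordered_ab_group_add list \<Rightarrow> 'a) \<Rightarrow> ('r \<Rightarrow> 'a list \<Rightarrow> bool) \<Rightarrow> bool" where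
  "locally_o_minimal F R \<longleftrightarrow>
     (\<forall>(X :: 'a set) a. definable1 F R X \<longrightarrow>
        (\<exists>u v. u < a \<and> a < v \<and> finite_union_points_intervals (X \<inter> {u<..<v})))"

definition absM :: "'a::linordered_ab_group_add \<Rightarrow> 'a" where
  "absM a = max a (- a)"

section \<open>Topology on M^k (product order topology), via the max-norm |x| = max |x_i|\<close>

definition close_to :: "'a::linordered_ab_group_add \<Rightarrow> 'a list \<Rightarrow> 'a list \<Rightarrow> bool" where
  "close_to \<delta> x y \<longleftrightarrow> length x = length y \<and> (\<forall>i < length x. absM (x ! i - y ! i) < \<delta>)"

definition closed_in_M :: "nat \<Rightarrow> 'a::linordered_ab_group_add list set \<Rightarrow> bool" where
  "closed_in_M k C \<longleftrightarrow>
     (\<forall>y. length y = k \<longrightarrow> y \<notin> C \<longrightarrow> (\<exists>\<delta>>0. \<forall>x\<in>C. \<not> close_to \<delta> x y))"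

definition continuous_at_CP ::
  "'a list set \<Rightarrow> 'a list set \<Rightarrow> ('a list \<Rightarrow> 'a list \<Rightarrow> 'a::linordered_ab_group_add) \<Rightarrow> 'a list \<Rightarrow> 'a list \<Rightarrow> bool" where
  "continuous_at_CP C P f x q \<longleftrightarrow>
     (\<forall>\<epsilon>>0. \<exists>\<delta>>0. \<forall>x'\<in>C. \<forall>q'\<in>P. close_to \<delta> x x' \<and> close_to \<delta> q q' \<longrightarrow>
        absM (f x q - f x' q') < \<epsilon>)"

definition equicontinuous_wrt ::
  "'a list set \<Rightarrow> 'a list set \<Rightarrow> ('a list \<Rightarrow> 'a list \<Rightarrow> 'a::linordered_ab_group_add) \<Rightarrow> bool" where
  "equicontinuous_wrt C P f \<longleftrightarrow>
     (\<forall>\<epsilon>>0. \<forall>x\<in>C. \<exists>\<delta>>0. \<forall>p\<in>P. \<forall>x'\<in>C. close_to \<delta> x x' \<longrightarrow> absM (f x p - f x' p) < \<epsilon>)"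

definition definable_fun ::
  "('f \<Rightarrow> 'a::linordered_ab_group_add list \<Rightarrow> 'a) \<Rightarrow> ('r \<Rightarrow> 'a list \<Rightarrow> bool) \<Rightarrow> nat \<Rightarrow> nat \<Rightarrow> 'a list set \<Rightarrow> 'a list set
     \<Rightarrow> ('a list \<Rightarrow> 'a list \<Rightarrow> 'a) \<Rightarrow> bool" where
  "definable_fun F R m n C P f \<longleftrightarrow>
     definable F R (m + n + 1) {x @ q @ [f x q] | x q. x \<in> C \<and> q \<in> P}"

text \<open>A coordinate projection M^n \<rightarrow> M^d is given by a strictly increasing list
  of d indices below n.\<close>

definition coord_proj :: "nat list \<Rightarrow> 'a list \<Rightarrow> 'a list" where
  "coord_proj is xs = map (\<lambda>i. xs ! i) is"

definition has_interior :: "'a::linordered_ab_group_add list set \<Rightarrow> bool" where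
  "has_interior S \<longleftrightarrow> (\<exists>y\<in>S. \<exists>\<delta>>0. \<forall>z. close_to \<delta> y z \<longrightarrow> z \<in> S)"

definition dim_witness :: "nat \<Rightarrow> 'a::linordered_ab_group_add list set \<Rightarrow> nat \<Rightarrow> bool" where
  "dim_witness n X d \<longleftrightarrow>
     (\<exists>is. length is = d \<and> sorted_wrt (<) is \<and> (\<forall>i\<in>set is. i < n) \<and>
           has_interior (coord_proj is ` X))"

text \<open>dim X (for X \<subseteq> M^n); the value -1 stands for -\<infinity> (dim of the empty set).\<close>

definition dim :: "nat \<Rightarrow> 'a::linordered_ab_group_add list set \<Rightarrow> int" where
  "dim n X = (if X = {} then -1 else int (GREATEST d. dim_witness n X d))"

end

theory Submission
  imports Defs
begin

text \<open>
  If the structure is trivial or discretely ordered then every function is continuous, so suppose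
  that it is densely ordered. Local o-minimality and definable completeness give, by induction on
  \<open>d\<close>, that every definable function on a ball of \<open>M\<^sup>d\<close> has a continuity point. As
  definable families have definable sections, a definable family with nonempty fibres over a ball has a
  point at which the fibres are lower semicontinuous.

  Let \<open>Z\<close> be the projection of the discontinuity set, \<open>d = dim Z\<close>, and \<open>U\<close> a ball
  contained in a coordinate projection of \<open>Z\<close> to \<open>M\<^sup>d\<close>. If \<open>dim P = d\<close> then,
  after shrinking \<open>U\<close>, the fibres of \<open>P\<close> over \<open>U\<close> are discrete. Apply the above to
  the family of tuples \<open>(\<rho>, f x q, x, q)\<close>, where \<open>f\<close> is discontinuous at \<open>(x, q)\<close>,
  \<open>q\<close> lies over \<open>u\<close>, and \<open>\<rho>\<close> isolates \<open>q\<close> in its fibre. At a point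
  of lower semicontinuity every \<open>q'\<close> in \<open>P\<close> near \<open>q\<close> occurs in a nearby tuple
  \<open>(\<rho>', f x' q', x', q')\<close>, and equi-continuity at \<open>x\<close> replaces \<open>x'\<close> by
  \<open>x\<close>; hence \<open>f\<close> is continuous at \<open>(x, q)\<close>, a contradiction.
\<close>

section \<open>Definable predicates of an environment\<close>

primrec rename_tm :: "(nat \<Rightarrow> nat) \<Rightarrow> 'f tm \<Rightarrow> 'f tm" where
  "rename_tm r (Var i) = Var (r i)"
| "rename_tm r Zero = Zero"
| "rename_tm r (Plus s t) = Plus (rename_tm r s) (rename_tm r t)"
| "rename_tm r (Fn g ts) = Fn g (map (rename_tm r) ts)"

primrec rename_fm :: "(nat \<Rightarrow> nat) \<Rightarrow> ('f, 'r) fm \<Rightarrow> ('f, 'r) fm" where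
  "rename_fm r (Eq s t) = Eq (rename_tm r s) (rename_tm r t)"
| "rename_fm r (Less s t) = Less (rename_tm r s) (rename_tm r t)"
| "rename_fm r (Rel q ts) = Rel q (map (rename_tm r) ts)"
| "rename_fm r (Not \<phi>) = Not (rename_fm r \<phi>)"
| "rename_fm r (And \<phi> \<psi>) = And (rename_fm r \<phi>) (rename_fm r \<psi>)"
| "rename_fm r (Ex v \<phi>) = Ex (r v) (rename_fm r \<phi>)"

lemma tm_eval_rename: "tm_eval F e (rename_tm r t) = tm_eval F (e \<circ> r) t"
  by (induction t) (auto cong: map_cong simp: comp_def)

text \<open>Injectivity keeps \<open>r v\<close> apart from the images of the other variables, so no
  variable is captured at a quantifier.\<close>

lemma sat_rename: "inj r \<Longrightarrow> sat F R e (rename_fm r \<phi>) = sat F R (e \<circ> r) \<phi>"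
proof (induction \<phi> arbitrary: e)
  case (Ex v \<phi>)
  have "(e(r v := a)) \<circ> r = (e \<circ> r)(v := a)" for a
    using Ex.prems by (auto simp: fun_eq_iff inj_eq)
  then show ?case using Ex.IH[OF Ex.prems] by (simp only: sat.simps rename_fm.simps)
qed (auto simp: tm_eval_rename comp_def cong: map_cong)

definition merge :: "(nat \<Rightarrow> 'a) \<Rightarrow> (nat \<Rightarrow> 'a) \<Rightarrow> nat \<Rightarrow> 'a" where
  "merge e p i = (if even i then e (i div 2) else p (i div 2))"

lemma nat_parity: "(\<And>j. i = 2 * j \<Longrightarrow> P) \<Longrightarrow> (\<And>j. i = Suc (2 * j) \<Longrightarrow> P) \<Longrightarrow> P" for i :: nat
  by (metis evenE oddE Suc_eq_plus1)

locale ordered_structure =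
  fixes F :: "'f \<Rightarrow> 'a::linordered_ab_group_add list \<Rightarrow> 'a"
    and R :: "'r \<Rightarrow> 'a list \<Rightarrow> bool"
begin

text \<open>Even variables carry the environment and odd ones the parameters, so that there is always
  room for further parameters. Quantifiers are treated with de Bruijn indices: the bound variable is
  \<open>e 0\<close> and the remaining environment is shifted.\<close>

definition dpred :: "((nat \<Rightarrow> 'a) \<Rightarrow> bool) \<Rightarrow> bool" where
  "dpred Q \<longleftrightarrow> (\<exists>(\<phi> :: ('f, 'r) fm) p. \<forall>e. Q e \<longleftrightarrow> sat F R (merge e p) \<phi>)"

text \<open>Terms are taken semantically, by a graph with the value in variable \<open>0\<close>, so
  that definable functions such as infima and sections can be substituted like syntactic
  terms.\<close>

definition dterm :: "((nat \<Rightarrow> 'a) \<Rightarrow> 'a) \<Rightarrow> bool" where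
  "dterm t \<longleftrightarrow> dpred (\<lambda>e. e 0 = t (\<lambda>i. e (Suc i)))"

definition dtuple :: "nat \<Rightarrow> ((nat \<Rightarrow> 'a) \<Rightarrow> 'a list) \<Rightarrow> bool" where
  "dtuple d l \<longleftrightarrow> (\<forall>e. length (l e) = d) \<and> (\<forall>i<d. dterm (\<lambda>e. l e ! i))"

lemma dpred_not: "dpred P \<Longrightarrow> dpred (\<lambda>e. \<not> P e)"
  unfolding dpred_def by (metis sat.simps(4))

lemma dpred_and:
  assumes "dpred P" "dpred Q"
  shows "dpred (\<lambda>e. P e \<and> Q e)"
proof -
  obtain \<phi> :: "('f, 'r) fm" and p where 1: "\<And>e. P e \<longleftrightarrow> sat F R (merge e p) \<phi>"
    using assms unfolding dpred_def by blast
  obtain \<psi> :: "('f, 'r) fm" and q where 2: "\<And>e. Q e \<longleftrightarrow> sat F R (merge e q) \<psi>"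
    using assms unfolding dpred_def by blast
  \<comment> \<open>The two parameter assignments are interleaved in \<open>merge p q\<close>: the
    parameter variable \<open>2 j + 1\<close> moves to \<open>4 j + 1\<close> for
    \<open>\<phi>\<close> and to \<open>4 j + 3\<close> for \<open>\<psi>\<close>, while the
    environment variables stay.\<close>
  define r where "r i = (if even i then i else 2 * i - 1)" for i :: nat
  define s where "s i = (if even i then i else 2 * i + 1)" for i :: nat
  have ir: "inj r" by (rule injI, rule_tac i = x in nat_parity, rule_tac i = y in nat_parity) (auto simp: r_def split: if_splits, presburger+)
  have js: "inj s" by (rule injI, rule_tac i = x in nat_parity, rule_tac i = y in nat_parity) (auto simp: s_def split: if_splits, presburger+)
  have a: "merge e (merge p q) \<circ> r = merge e p" for e
  proof
    fix i show "(merge e (merge p q) \<circ> r) i = merge e p i"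
      by (rule nat_parity[of i])  (auto simp: merge_def r_def)
  qed
  have b: "merge e (merge p q) \<circ> s = merge e q" for e
  proof
    fix i show "(merge e (merge p q) \<circ> s) i = merge e q i"
      by (rule nat_parity[of i])  (auto simp: merge_def s_def)
  qed
  have "\<forall>e. (P e \<and> Q e) \<longleftrightarrow> sat F R (merge e (merge p q)) (And (rename_fm r \<phi>) (rename_fm s \<psi>))"
    by (simp add: sat_rename ir js a b 1 2)
  then show ?thesis unfolding dpred_def by blast
qed

lemma dpred_ex:
  assumes "dpred (\<lambda>e. P (\<lambda>i. e (Suc i)) (e 0))"
  shows "dpred (\<lambda>e. \<exists>a. P e a)"
proof -
  obtain \<phi> :: "('f, 'r) fm" and p
    where 1: "\<And>e. P (\<lambda>i. e (Suc i)) (e 0) \<longleftrightarrow> sat F R (merge e p) \<phi>"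
    using assms unfolding dpred_def by blast
  \<comment> \<open>The bound variable takes the first parameter slot, variable \<open>1\<close>,
    whose value \<open>0\<close> in \<open>case_nat 0 p\<close> is a dummy. The environment moves
    down one place and the parameters move up one.\<close>
  define r where "r i = (if i = 0 then 1 else if even i then i - 2 else i + 2)" for i :: nat
  have ir: "inj r" by (rule injI, rule_tac i = x in nat_parity, rule_tac i = y in nat_parity) (auto simp: r_def split: if_splits, presburger+)
  have a: "(merge e (case_nat 0 p))(1 := a) \<circ> r = merge (case_nat a e) p" for e a
  proof
    fix i
    consider "i = 0" | j where "i = 2 * Suc j" | j where "i = 2 * j + 1"
      by (metis oddE evenE not0_implies_Suc mult_0_right)
    then show "((merge e (case_nat 0 p))(1 := a) \<circ> r) i = merge (case_nat a e) p i"
      by cases (auto simp: merge_def r_def)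
  qed
  have "\<forall>e. (\<exists>a. P e a) \<longleftrightarrow> sat F R (merge e (case_nat 0 p)) (Ex 1 (rename_fm r \<phi>))"
  proof
    fix e
    have "P e a \<longleftrightarrow> sat F R (merge (case_nat a e) p) \<phi>" for a
      using 1[of "case_nat a e"] by simp
    then show "(\<exists>a. P e a) \<longleftrightarrow> sat F R (merge e (case_nat 0 p)) (Ex 1 (rename_fm r \<phi>))"
      by (simp add: sat_rename ir a del: One_nat_def)
  qed
  then show ?thesis unfolding dpred_def by blast
qed

lemma dpred_const: "dpred (\<lambda>e. c)"
proof -
  have "dpred (\<lambda>e. e 0 = e 0)" "dpred (\<lambda>e. e 0 < e 0)"
    unfolding dpred_def
    by (rule exI[of _ "Eq (Var 0) (Var 0)"], simp) (rule exI[of _ "Less (Var 0) (Var 0)"], simp)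
  then show ?thesis by (cases c) auto
qed

lemma dpred_or: "dpred P \<Longrightarrow> dpred Q \<Longrightarrow> dpred (\<lambda>e. P e \<or> Q e)"
  using dpred_not[OF dpred_and[OF dpred_not dpred_not], of P Q] by simp

lemma dpred_imp: "dpred P \<Longrightarrow> dpred Q \<Longrightarrow> dpred (\<lambda>e. P e \<longrightarrow> Q e)"
  using dpred_or[OF dpred_not, of P Q] by simp

lemma dpred_all: "dpred (\<lambda>e. P (\<lambda>i. e (Suc i)) (e 0)) \<Longrightarrow> dpred (\<lambda>e. \<forall>a. P e a)"
  using dpred_not[OF dpred_ex[of "\<lambda>e a. \<not> P e a"]] dpred_not by simp

lemma dpred_ball_less: "(\<And>i. i < (n::nat) \<Longrightarrow> dpred (P i)) \<Longrightarrow> dpred (\<lambda>e. \<forall>i<n. P i e)"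
proof (induction n)
  case (Suc n)
  then have "dpred (\<lambda>e. (\<forall>i<n. P i e) \<and> P n e)" by (intro dpred_and) auto
  then show ?case by (simp only: All_less_Suc conj_commute)
qed (simp add: dpred_const)

lemma dpred_reindex:
  assumes "dpred P"
  shows "dpred (\<lambda>e. P (\<lambda>i. e (Suc i)))"
proof -
  obtain \<phi> :: "('f, 'r) fm" and p where 1: "\<And>e. P e \<longleftrightarrow> sat F R (merge e p) \<phi>"
    using assms unfolding dpred_def by blast
  define r where "r i = (if even i then i + 2 else i)" for i :: nat
  have ir: "inj r" by (rule injI, rule_tac i = x in nat_parity, rule_tac i = y in nat_parity) (auto simp: r_def split: if_splits, presburger+)
  have "merge e p \<circ> r = merge (\<lambda>i. e (Suc i)) p" for e
    by (auto simp: fun_eq_iff merge_def r_def)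
  then have "\<forall>e. P (\<lambda>i. e (Suc i)) \<longleftrightarrow> sat F R (merge e p) (rename_fm r \<phi>)"
    by (simp add: sat_rename ir 1)
  then show ?thesis unfolding dpred_def by blast
qed

lemma dpred_atomI: "(\<And>e. Q e \<longleftrightarrow> sat F R (merge e p) \<phi>) \<Longrightarrow> dpred Q"
  unfolding dpred_def by blast

lemma dpred_var_eq: "dpred (\<lambda>e. e i = e j)"
  by (rule dpred_atomI[of _ undefined "Eq (Var (2*i)) (Var (2*j))"]) (simp add: merge_def)

lemma dpred_var_less: "dpred (\<lambda>e. e i < e j)"
  by (rule dpred_atomI[of _ undefined "Less (Var (2*i)) (Var (2*j))"]) (simp add: merge_def)

lemma dpred_var_eq_const: "dpred (\<lambda>e. e i = c)"
  by (rule dpred_atomI[of _ "\<lambda>_. c" "Eq (Var (2*i)) (Var 1)"]) (simp add: merge_def)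

lemma dpred_var_plus: "dpred (\<lambda>e. e i = e j + e k)"
  by (rule dpred_atomI[of _ undefined "Eq (Var (2*i)) (Plus (Var (2*j)) (Var (2*k)))"]) (simp add: merge_def)

lemma dpred_var_Fn: "dpred (\<lambda>e. e i = F g (map (\<lambda>j. e (r j)) [0..<k]))"
  by (rule dpred_atomI[of _ undefined "Eq (Var (2*i)) (Fn g (map (\<lambda>j. Var (2 * r j)) [0..<k]))"])
    (simp add: merge_def comp_def)

lemma dpred_var_Rel: "dpred (\<lambda>e. R q (map (\<lambda>j. e (r j)) [0..<k]))"
  by (rule dpred_atomI[of _ undefined "Rel q (map (\<lambda>j. Var (2 * r j)) [0..<k])"])
    (simp add: merge_def comp_def)

lemma dterm_var: "dterm (\<lambda>e. e i)"
  unfolding dterm_def by (rule dpred_var_eq)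

lemma dterm_const: "dterm (\<lambda>e. c)"
  unfolding dterm_def by (rule dpred_var_eq_const)

text \<open>Weakening behind the front variable: in the graph of a term, variable \<open>0\<close>
  holds the value and must stay in place while the environment moves.\<close>

lemma dpred_skip:
  assumes "dpred (\<lambda>e. P (e 0) (\<lambda>i. e (Suc i)))"
  shows "dpred (\<lambda>e. P (e 0) (\<lambda>i. e (Suc (Suc i))))"
proof -
  obtain \<phi> :: "('f, 'r) fm" and p
    where 1: "\<And>e. P (e 0) (\<lambda>i. e (Suc i)) \<longleftrightarrow> sat F R (merge e p) \<phi>"
    using assms unfolding dpred_def by blast
  define r where "r i = (if even i \<and> i > 0 then i + 2 else i)" for i :: nat
  have ir: "inj r"
    by (rule injI, rule_tac i = x in nat_parity, rule_tac i = y in nat_parity) (auto simp: r_def split: if_splits, presburger+)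
  have "merge e p \<circ> r = merge (case_nat (e 0) (\<lambda>i. e (Suc (Suc i)))) p" for e
    by (auto simp: fun_eq_iff merge_def r_def split: nat.split)
  then have "\<forall>e. P (e 0) (\<lambda>i. e (Suc (Suc i))) \<longleftrightarrow> sat F R (merge e p) (rename_fm r \<phi>)"
    using 1[of "case_nat (e 0) (\<lambda>i. e (Suc (Suc i)))" for e] by (simp add: sat_rename ir)
  then show ?thesis unfolding dpred_def by blast
qed

lemma dterm_shift: "dterm t \<Longrightarrow> dterm (\<lambda>e. t (\<lambda>i. e (Suc i)))"
  unfolding dterm_def by (rule dpred_skip[where P = "\<lambda>a e. a = t e"])

lemma dpred_subst1:
  assumes "dterm t" "dpred (\<lambda>e. P (e 0) (\<lambda>i. e (Suc i)))"
  shows "dpred (\<lambda>e. P (t e) e)"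
proof -
  have "dpred (\<lambda>e. \<exists>a. a = t e \<and> P a e)"
    using assms unfolding dterm_def by (intro dpred_ex dpred_and)
  then show ?thesis by simp
qed

lemma dtuple_intro: "(\<And>e. length (l e) = d) \<Longrightarrow> (\<And>i. i < d \<Longrightarrow> dterm (\<lambda>e. l e ! i)) \<Longrightarrow> dtuple d l"
  unfolding dtuple_def by blast

lemma dtuple_length: "dtuple d l \<Longrightarrow> length (l e) = d"
  unfolding dtuple_def by blast

lemma dterm_nth: "dtuple d l \<Longrightarrow> i < d \<Longrightarrow> dterm (\<lambda>e. l e ! i)"
  unfolding dtuple_def by blast

lemma dtuple_Cons: "dterm t \<Longrightarrow> dtuple d l \<Longrightarrow> dtuple (Suc d) (\<lambda>e. t e # l e)"
  unfolding dtuple_def by (auto simp: less_Suc_eq_0_disj)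

lemma dtuple_Nil: "dtuple 0 (\<lambda>e. [])"
  unfolding dtuple_def by auto

lemma dtuple_shift: "dtuple d l \<Longrightarrow> dtuple d (\<lambda>e. l (\<lambda>i. e (Suc i)))"
  unfolding dtuple_def using dterm_shift by blast

lemma dpred_ex_list:
  "dpred (\<lambda>e. P (\<lambda>i. e (i + d)) (map e [0..<d])) \<Longrightarrow> dpred (\<lambda>e. \<exists>xs. length xs = d \<and> P e xs)"
proof (induction d arbitrary: P)
  case 0
  then show ?case by simp
next
  case (Suc d)

  \<comment> \<open>The last entry is quantified outermost: the \<open>d\<close> inner binders push
    it to index \<open>d\<close>, which is its place in the tuple.\<close>
  have "dpred (\<lambda>e. \<exists>x. \<exists>xs. length xs = d \<and> P e (xs @ [x]))"
  proof (rule dpred_ex, rule Suc.IH)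
    show "dpred (\<lambda>e. P (\<lambda>i. e (Suc i + d)) (map e [0..<d] @ [e (0 + d)]))"
      using Suc.prems by simp
  qed
  moreover have "(\<exists>x xs. length xs = d \<and> P e (xs @ [x])) \<longleftrightarrow> (\<exists>xs. length xs = Suc d \<and> P e xs)" for e
    by (metis length_append_singleton length_Suc_conv_rev)
  ultimately show ?case by simp
qed

lemma dpred_all_list:
  "dpred (\<lambda>e. P (\<lambda>i. e (i + d)) (map e [0..<d])) \<Longrightarrow> dpred (\<lambda>e. \<forall>xs. length xs = d \<longrightarrow> P e xs)"
  using dpred_not[OF dpred_ex_list[of "\<lambda>e a. \<not> P e a"]] dpred_not by simp

lemma dterm_shiftn: "dterm t \<Longrightarrow> dterm (\<lambda>e. t (\<lambda>i. e (i + d)))"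
proof (induction d)
  case (Suc d)
  from dterm_shift[OF Suc.IH[OF Suc.prems]] show ?case by simp
qed simp

lemma dpred_eq: "dterm s \<Longrightarrow> dterm t \<Longrightarrow> dpred (\<lambda>e. s e = t e)"
  using dpred_subst1[of t "\<lambda>a e. s e = a"] unfolding dterm_def by (simp add: eq_commute)

lemma dpred_less:
  assumes "dterm s" "dterm t"
  shows "dpred (\<lambda>e. s e < t e)"
proof -
  have "dpred (\<lambda>e. e 0 < t (\<lambda>i. e (Suc i)))"
    using dpred_subst1[OF dterm_shift[OF assms(2)], of "\<lambda>a e. e 0 < a"] dpred_var_less by simp
  then show ?thesis using dpred_subst1[OF assms(1), of "\<lambda>a e. a < t e"] by simp
qed

lemma dpred_le: "dterm s \<Longrightarrow> dterm t \<Longrightarrow> dpred (\<lambda>e. s e \<le> t e)"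
  using dpred_not[OF dpred_less[of t s]] by (simp add: not_less)

lemma dterm_plus:
  assumes "dterm s" "dterm t"
  shows "dterm (\<lambda>e. s e + t e)"
proof -
  have "dpred (\<lambda>e. \<exists>b. b = t (\<lambda>i. e (Suc (Suc i))) \<and> e 1 = e 0 + b)"
    by (intro dpred_ex dpred_and dpred_var_plus dpred_eq dterm_var dterm_shift[of t] dterm_shift[of "\<lambda>e. t (\<lambda>i. e (Suc i))"]
        dterm_shift[of "\<lambda>e. t (\<lambda>i. e (Suc (Suc i)))"] assms dpred_var_plus)
  then have "dpred (\<lambda>e. e 1 = e 0 + t (\<lambda>i. e (Suc (Suc i))))" by simp
  then show ?thesis
    using dpred_subst1[OF dterm_shift[OF assms(1)], of "\<lambda>a e. e 0 = a + t (\<lambda>i. e (Suc i))"]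
    unfolding dterm_def by simp
qed

lemma dterm_uminus: "dterm t \<Longrightarrow> dterm (\<lambda>e. - t e)"
proof -
  assume t: "dterm t"
  have "dpred (\<lambda>e. e 0 + t (\<lambda>i. e (Suc i)) = 0)"
    by (intro dpred_eq dterm_plus dterm_shift[OF t] dterm_const dterm_var)
  then show ?thesis unfolding dterm_def by (simp add: eq_neg_iff_add_eq_0)
qed

lemma dterm_minus: "dterm s \<Longrightarrow> dterm t \<Longrightarrow> dterm (\<lambda>e. s e - t e)"
  using dterm_plus[OF _ dterm_uminus, of s t] by simp

lemma dterm_if:
  assumes "dpred P" "dterm s" "dterm t"
  shows "dterm (\<lambda>e. if P e then s e else t e)"
proof -
  have "dpred (\<lambda>e. (P (\<lambda>i. e (Suc i)) \<and> e 0 = s (\<lambda>i. e (Suc i)))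
     \<or> (\<not> P (\<lambda>i. e (Suc i)) \<and> e 0 = t (\<lambda>i. e (Suc i))))"
    by (intro dpred_or dpred_and dpred_not dpred_reindex[OF assms(1)] dpred_eq dterm_shift[OF assms(2)]
        dterm_shift[OF assms(3)] dterm_var)
  then show ?thesis unfolding dterm_def by (rule back_subst[of dpred]) auto
qed

text \<open>Quantifying over a list \<open>xs\<close> equal to \<open>l e\<close> reduces arbitrary
  tuples of definable functions to tuples of variables.\<close>

lemma dpred_list_atom:
  assumes "dtuple k l" "dpred (\<lambda>e. P (map e [0..<k]) (\<lambda>i. e (i + k)))"
  shows "dpred (\<lambda>e. P (l e) e)"
proof -
  have "dpred (\<lambda>e. \<exists>xs. length xs = k \<and> ((\<forall>i<k. xs ! i = l e ! i) \<and> P xs e))"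
  proof (intro dpred_ex_list dpred_and dpred_ball_less dpred_eq assms(2))
    fix i assume "i < k"
    show "dterm (\<lambda>e. map e [0..<k] ! i)" using dterm_var[of i] \<open>i < k\<close> by simp
    show "dterm (\<lambda>e. l (\<lambda>i. e (i + k)) ! i)"
      using dterm_shiftn[OF dterm_nth[OF assms(1) \<open>i < k\<close>]] .
  qed
  moreover have "(\<exists>xs. length xs = k \<and> ((\<forall>i<k. xs ! i = l e ! i) \<and> P xs e)) \<longleftrightarrow> P (l e) e" for e
    using dtuple_length[OF assms(1), of e] by (metis nth_equalityI)
  ultimately show ?thesis by simp
qed

lemma dterm_Fn: "dtuple k l \<Longrightarrow> dterm (\<lambda>e. F g (l e))"
  unfolding dterm_def
  by (rule dpred_list_atom[of k "\<lambda>e. l (\<lambda>i. e (Suc i))" "\<lambda>a e. e 0 = F g a"])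
    (auto intro: dtuple_shift dpred_var_Fn[of _ _ "\<lambda>x. x"])

lemma dpred_Rel: "dtuple k l \<Longrightarrow> dpred (\<lambda>e. R q (l e))"
  by (rule dpred_list_atom[of k l "\<lambda>a e. R q a"]) (auto intro: dpred_var_Rel[of _ "\<lambda>x. x"])

lemma dtuple_map_list:
  "(\<And>x. x \<in> set xs \<Longrightarrow> dterm (t x)) \<Longrightarrow> length xs = d \<Longrightarrow> dtuple d (\<lambda>e. map (\<lambda>x. t x e) xs)"
  unfolding dtuple_def by auto

section \<open>Substitution of definable functions into formulas\<close>

lemma dterm_tm_eval: "(\<And>i. dterm (\<sigma> i)) \<Longrightarrow> dterm (\<lambda>e. tm_eval F (\<lambda>i. \<sigma> i e) t)"
proof (induction t)
  case (Fn g ts)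
  show ?case
    using dterm_Fn[OF dtuple_map_list[of ts "\<lambda>t e. tm_eval F (\<lambda>i. \<sigma> i e) t"]] Fn by simp
qed (auto intro: dterm_const dterm_plus)

text \<open>Induction on the formula, for all \<open>\<sigma>\<close> at once: at a quantifier,
  \<open>v\<close> is sent to the new front variable and every other entry of
  \<open>\<sigma>\<close> is shifted past it.\<close>

lemma dpred_sat_subst: "(\<And>i. dterm (\<sigma> i)) \<Longrightarrow> dpred (\<lambda>e. sat F R (\<lambda>i. \<sigma> i e) \<phi>)"
proof (induction \<phi> arbitrary: \<sigma>)
  case (Eq s t)
  then show ?case using dpred_eq[OF dterm_tm_eval dterm_tm_eval] by simp
next
  case (Less s t)
  then show ?case using dpred_less[OF dterm_tm_eval dterm_tm_eval] by simp
next
  case (Rel q ts)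
  show ?case
    using dpred_Rel[OF dtuple_map_list[of ts "\<lambda>t e. tm_eval F (\<lambda>i. \<sigma> i e) t"]] dterm_tm_eval[OF Rel] by simp
next
  case (Ex v \<phi>)
  have "dpred (\<lambda>e. sat F R (\<lambda>i. (if i = v then (\<lambda>e. e 0) else (\<lambda>e. \<sigma> i (\<lambda>i. e (Suc i)))) e) \<phi>)"
    by (rule Ex.IH) (auto intro: dterm_var dterm_shift Ex.prems)
  then have "dpred (\<lambda>e. sat F R ((\<lambda>i. \<sigma> i (\<lambda>i. e (Suc i)))(v := e 0)) \<phi>)"
    by (rule back_subst[of dpred]) (auto simp: fun_eq_iff intro!: arg_cong[of _ _ "\<lambda>e. sat F R e \<phi>"])
  then show ?case using dpred_ex[of "\<lambda>e a. sat F R ((\<lambda>i. \<sigma> i e)(v := a)) \<phi>"] by simp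
qed (auto intro: dpred_not dpred_and)

lemma dpred_subst:
  assumes "dpred Q" "\<And>i. dterm (\<sigma> i)"
  shows "dpred (\<lambda>e. Q (\<lambda>i. \<sigma> i e))"
proof -
  obtain \<phi> :: "('f, 'r) fm" and p where 1: "\<And>e. Q e \<longleftrightarrow> sat F R (merge e p) \<phi>"
    using assms unfolding dpred_def by blast
  have "dpred (\<lambda>e. sat F R (\<lambda>i. (if even i then \<sigma> (i div 2) else (\<lambda>e. p (i div 2))) e) \<phi>)"
    using assms(2) dterm_const by (intro dpred_sat_subst) auto
  then show ?thesis
    by (rule back_subst[of dpred])
      (auto simp: fun_eq_iff 1 merge_def intro!: arg_cong[of _ _ "\<lambda>e. sat F R e \<phi>"])
qed

lemma definable_imp_dpred:
  assumes "definable F R k X" "dtuple k l"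
  shows "dpred (\<lambda>e. l e \<in> X)"
proof -
  obtain \<phi> :: "('f, 'r) fm" and p
    where 1: "X = {xs. length xs = k \<and> sat F R (\<lambda>i. if i < k then xs ! i else p i) \<phi>}"
    using assms unfolding definable_def by blast
  have "dpred (\<lambda>e. sat F R (\<lambda>i. (if i < k then (\<lambda>e. l e ! i) else (\<lambda>e. p i)) e) \<phi>)"
    using assms(2) dterm_const dterm_nth by (intro dpred_sat_subst) auto
  then show ?thesis
    by (rule back_subst[of dpred])
      (auto simp: fun_eq_iff 1 dtuple_length[OF assms(2)] intro!: arg_cong[of _ _ "\<lambda>e. sat F R e \<phi>"])
qed

lemma dpred_imp_definable1:
  assumes "dpred (\<lambda>e. A (e 0))"
  shows "definable1 F R {x. A x}"
proof -
  obtain \<phi> :: "('f, 'r) fm" and p where 1: "\<And>e. A (e 0) \<longleftrightarrow> sat F R (merge e p) \<phi>"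
    using assms unfolding dpred_def by blast
  \<comment> \<open>Only \<open>e 0\<close> matters to \<open>A\<close>, so the remaining
    environment variables can be frozen at \<open>0\<close> and counted among the
    parameters.\<close>
  have "merge (\<lambda>i. if i = 0 then x else 0) p = (\<lambda>i. if i < 1 then [x] ! i else merge (\<lambda>_. 0) p i)" for x
    by (auto simp: fun_eq_iff merge_def elim!: evenE)
  then have "A x \<longleftrightarrow> sat F R (\<lambda>i. if i < 1 then [x] ! i else merge (\<lambda>_. 0) p i) \<phi>" for x
    using 1[of "\<lambda>i. if i = 0 then x else 0"] by simp
  then have "(\<lambda>x. [x]) ` {x. A x} = {xs. length xs = 1 \<and>
      sat F R (\<lambda>i. if i < 1 then xs ! i else merge (\<lambda>_. 0) p i) \<phi>}"
    by (auto simp: length_Suc_conv)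
  then show ?thesis unfolding definable1_def definable_def by blast
qed

end

context ordered_structure begin

section \<open>Definable predicates and functions of scalars and tuples\<close>

lemma dterm_subst:
  assumes "dterm t" "\<And>i. dterm (\<sigma> i)"
  shows "dterm (\<lambda>e. t (\<lambda>i. \<sigma> i e))"
proof -
  \<comment> \<open>Variable \<open>0\<close> of the graph carries the value of \<open>t\<close> and
    is kept; the variables behind it receive \<open>\<sigma>\<close>, shifted past that
    value.\<close>
  define \<tau> where "\<tau> = case_nat (\<lambda>e. e 0) (\<lambda>i e. \<sigma> i (\<lambda>i. e (Suc i)))"
  have "dterm (\<tau> i)" for i
    unfolding \<tau>_def using dterm_var dterm_shift[OF assms(2)] by (cases i) simp_all
  from dpred_subst[OF assms(1)[unfolded dterm_def], of \<tau>, OF this] show ?thesis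
    unfolding dterm_def \<tau>_def by simp
qed

text \<open>Here and below, definability is phrased as stability under substitution of definable
  functions, a form that serves as an introduction rule under any number of binders. In the names,
  \<open>s\<close> stands for a scalar argument, \<open>l\<close> for a tuple and \<open>f\<close>
  for a function.\<close>

definition def_s :: "('a \<Rightarrow> bool) \<Rightarrow> bool" where
  "def_s Q \<longleftrightarrow> (\<forall>t. dterm t \<longrightarrow> dpred (\<lambda>e. Q (t e)))"

definition def_ss :: "('a \<Rightarrow> 'a \<Rightarrow> bool) \<Rightarrow> bool" where
  "def_ss Q \<longleftrightarrow> (\<forall>s t. dterm s \<longrightarrow> dterm t \<longrightarrow> dpred (\<lambda>e. Q (s e) (t e)))"

definition def_f1 :: "('a \<Rightarrow> 'a) \<Rightarrow> bool" where
  "def_f1 h \<longleftrightarrow> (\<forall>t. dterm t \<longrightarrow> dterm (\<lambda>e. h (t e)))"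

definition def_l :: "nat \<Rightarrow> ('a list \<Rightarrow> bool) \<Rightarrow> bool" where
  "def_l d Q \<longleftrightarrow> (\<forall>l. dtuple d l \<longrightarrow> dpred (\<lambda>e. Q (l e)))"

definition def_sl :: "nat \<Rightarrow> ('a \<Rightarrow> 'a list \<Rightarrow> bool) \<Rightarrow> bool" where
  "def_sl d Q \<longleftrightarrow> (\<forall>t l. dterm t \<longrightarrow> dtuple d l \<longrightarrow> dpred (\<lambda>e. Q (t e) (l e)))"

definition def_ll :: "nat \<Rightarrow> nat \<Rightarrow> ('a list \<Rightarrow> 'a list \<Rightarrow> bool) \<Rightarrow> bool" where
  "def_ll k d Q \<longleftrightarrow> (\<forall>s l. dtuple k s \<longrightarrow> dtuple d l \<longrightarrow> dpred (\<lambda>e. Q (s e) (l e)))"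

definition def_f :: "nat \<Rightarrow> ('a list \<Rightarrow> 'a) \<Rightarrow> bool" where
  "def_f d g \<longleftrightarrow> (\<forall>l. dtuple d l \<longrightarrow> dterm (\<lambda>e. g (l e)))"

lemma def_sD: "def_s Q \<Longrightarrow> dterm t \<Longrightarrow> dpred (\<lambda>e. Q (t e))"
  unfolding def_s_def by blast

lemma def_ssD: "def_ss Q \<Longrightarrow> dterm s \<Longrightarrow> dterm t \<Longrightarrow> dpred (\<lambda>e. Q (s e) (t e))"
  unfolding def_ss_def by blast

lemma def_f1D: "def_f1 h \<Longrightarrow> dterm t \<Longrightarrow> dterm (\<lambda>e. h (t e))"
  unfolding def_f1_def by blast

lemma def_lD: "def_l d Q \<Longrightarrow> dtuple d l \<Longrightarrow> dpred (\<lambda>e. Q (l e))"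
  unfolding def_l_def by blast

lemma def_slD: "def_sl d Q \<Longrightarrow> dterm t \<Longrightarrow> dtuple d l \<Longrightarrow> dpred (\<lambda>e. Q (t e) (l e))"
  unfolding def_sl_def by blast

lemma def_llD: "def_ll k d Q \<Longrightarrow> dtuple k s \<Longrightarrow> dtuple d l \<Longrightarrow> dpred (\<lambda>e. Q (s e) (l e))"
  unfolding def_ll_def by blast

lemma def_fD: "def_f d g \<Longrightarrow> dtuple d l \<Longrightarrow> dterm (\<lambda>e. g (l e))"
  unfolding def_f_def by blast

lemma def_sI: "dpred (\<lambda>e. Q (e 0)) \<Longrightarrow> def_s Q"
  unfolding def_s_def using dpred_subst[of "\<lambda>e. Q (e 0)" "\<lambda>i. t" for t] by simp

lemma def_ssI:
  assumes "dpred (\<lambda>e. Q (e 0) (e (Suc 0)))"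
  shows "def_ss Q"
  unfolding def_ss_def
proof (intro allI impI)
  fix s t assume "dterm s" "dterm t"
  then have "dterm (if i = 0 then s else t)" for i :: nat by auto
  from dpred_subst[OF assms, of "\<lambda>i. if i = 0 then s else t", OF this] show "dpred (\<lambda>e. Q (s e) (t e))" by simp
qed

lemma def_f1I:
  assumes "dterm (\<lambda>e. h (e 0))"
  shows "def_f1 h"
  unfolding def_f1_def using dterm_subst[OF assms, of "\<lambda>i. t" for t] by simp

lemma dterm_list_family: "dtuple d l \<Longrightarrow> dterm (if i < d then (\<lambda>e. l e ! i) else (\<lambda>e. c))"
  by (auto intro: dterm_nth dterm_const)

lemma def_lI:
  assumes "dpred (\<lambda>e. Q (map e [0..<d]))"
  shows "def_l d Q"
  unfolding def_l_def
proof (intro allI impI)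
  fix l assume l: "dtuple d l"
  have *: "map (\<lambda>i. (if i < d then (\<lambda>e. l e ! i) else (\<lambda>e. 0)) e) [0..<d] = l e" for e
    by (rule nth_equalityI) (auto simp: dtuple_length[OF l])
  show "dpred (\<lambda>e. Q (l e))"
    using dpred_subst[OF assms, of "\<lambda>i. if i < d then (\<lambda>e. l e ! i) else (\<lambda>e. 0)", OF dterm_list_family[OF l]] by (simp only: *)
qed

lemma def_fI:
  assumes "dterm (\<lambda>e. g (map e [0..<d]))"
  shows "def_f d g"
  unfolding def_f_def
proof (intro allI impI)
  fix l assume l: "dtuple d l"
  have *: "map (\<lambda>i. (if i < d then (\<lambda>e. l e ! i) else (\<lambda>e. 0)) e) [0..<d] = l e" for e
    by (rule nth_equalityI) (auto simp: dtuple_length[OF l])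
  show "dterm (\<lambda>e. g (l e))"
    using dterm_subst[OF assms, of "\<lambda>i. if i < d then (\<lambda>e. l e ! i) else (\<lambda>e. 0)", OF dterm_list_family[OF l]] by (simp only: *)
qed

lemma def_llI:
  assumes "dpred (\<lambda>e. Q (map e [0..<k]) (map (\<lambda>i. e (i + k)) [0..<d]))"
  shows "def_ll k d Q"
  unfolding def_ll_def
proof (intro allI impI)
  fix s l assume s: "dtuple k s" and l: "dtuple d l"
  define \<sigma> where "\<sigma> i = (if i < k then (\<lambda>e. s e ! i)
    else if i - k < d then (\<lambda>e. l e ! (i - k)) else (\<lambda>e. 0))" for i
  have \<sigma>: "dterm (\<sigma> i)" for i
    by (auto simp: \<sigma>_def intro: dterm_nth[OF s] dterm_nth[OF l] dterm_const)
  have 1: "map (\<lambda>i. \<sigma> i e) [0..<k] = s e" for e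
    by (rule nth_equalityI) (auto simp: dtuple_length[OF s] \<sigma>_def)
  have 2: "map (\<lambda>i. \<sigma> (i + k) e) [0..<d] = l e" for e
    by (rule nth_equalityI) (auto simp: dtuple_length[OF l] \<sigma>_def)
  show "dpred (\<lambda>e. Q (s e) (l e))" using dpred_subst[OF assms, of \<sigma>, OF \<sigma>] by (simp only: 1 2)
qed

lemma def_slI:
  assumes "dpred (\<lambda>e. Q (e 0) (map (\<lambda>i. e (Suc i)) [0..<d]))"
  shows "def_sl d Q"
  unfolding def_sl_def
proof (intro allI impI)
  fix t l assume t: "dterm t" and l: "dtuple d l"
  have "def_ll 1 d (\<lambda>s. Q (s ! 0))" using assms by (intro def_llI) simp
  from def_llD[OF this, of "\<lambda>e. [t e]" l] show "dpred (\<lambda>e. Q (t e) (l e))"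
    using dtuple_Cons[OF t dtuple_Nil] l by simp
qed

lemma dtuple_vars: "dtuple d (\<lambda>e. map (\<lambda>i. e (r i)) [0..<d])"
  unfolding dtuple_def by (auto intro: dterm_var)

lemma dtuple_const: "length c = d \<Longrightarrow> dtuple d (\<lambda>e. c)"
  unfolding dtuple_def by (auto intro: dterm_const)

lemma dtuple_append: "dtuple a l \<Longrightarrow> dtuple b m \<Longrightarrow> dtuple (a + b) (\<lambda>e. l e @ m e)"
proof (rule dtuple_intro)
  assume l: "dtuple a l" and m: "dtuple b m"
  then show "length (l e @ m e) = a + b" for e by (simp add: dtuple_length)
  show "dterm (\<lambda>e. (l e @ m e) ! i)" if "i < a + b" for i
    using dterm_nth[OF l, of i] dterm_nth[OF m, of "i - a"] that
    by (cases "i < a") (simp_all add: nth_append dtuple_length[OF l])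
qed

lemma dtuple_coord_proj:
  "(\<And>i. i \<in> set is \<Longrightarrow> i < n) \<Longrightarrow> length is = d \<Longrightarrow> dtuple n l \<Longrightarrow> dtuple d (\<lambda>e. coord_proj is (l e))"
  unfolding dtuple_def coord_proj_def by auto

lemma dpred_eq_list:
  assumes "dtuple d l" "dtuple d m"
  shows "dpred (\<lambda>e. l e = m e)"
proof -
  have "dpred (\<lambda>e. \<forall>i<d. l e ! i = m e ! i)"
    by (intro dpred_ball_less dpred_eq dterm_nth[OF assms(1)] dterm_nth[OF assms(2)])
  then show ?thesis using assms by (simp add: dtuple_def list_eq_iff_nth_eq)
qed

lemma dterm_absM: "dterm t \<Longrightarrow> dterm (\<lambda>e. absM (t e))"
  unfolding absM_def max_def by (intro dterm_if dpred_le dterm_uminus)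

lemma dpred_close_to:
  assumes "dterm t" "dtuple d l" "dtuple d m"
  shows "dpred (\<lambda>e. close_to (t e) (l e) (m e))"
  unfolding close_to_def dtuple_length[OF assms(2)] dtuple_length[OF assms(3)] simp_thms
  by (intro dpred_ball_less dpred_less dterm_absM dterm_minus dterm_nth[OF assms(2)] dterm_nth[OF assms(3)] assms)

lemma dpred_iff: "dpred P \<Longrightarrow> dpred Q \<Longrightarrow> dpred (\<lambda>e. P e \<longleftrightarrow> Q e)"
  unfolding iff_conv_conj_imp by (intro dpred_and dpred_imp)

lemmas definability_intros = dpred_ex dpred_all dpred_ex_list dpred_all_list dpred_and dpred_or dpred_not dpred_imp dpred_iff dpred_eq dpred_less dpred_le
  dpred_eq_list dpred_close_to dpred_const dterm_plus dterm_minus dterm_uminus dterm_absM dterm_if dterm_var dterm_const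
  dtuple_vars dtuple_vars[where r = "\<lambda>i. i"] dtuple_Cons dtuple_Nil dtuple_append dtuple_const

lemma def_f_Cons: "def_f (Suc d) g \<Longrightarrow> length u = d \<Longrightarrow> def_f1 (\<lambda>t. g (t # u))"
  by (rule def_f1I, rule def_fD[of "Suc d" g], assumption, intro definability_intros)

lemma def_f_Cons2: "def_f (Suc d) g \<Longrightarrow> def_f d (\<lambda>u. g (t # u))"
  by (rule def_fI, rule def_fD[of "Suc d" g], assumption, intro definability_intros)

end

section \<open>Absolute value and max-norm\<close>

lemma absM_less_iff: "absM x < d \<longleftrightarrow> x < d \<and> - d < x" for x :: "'a::linordered_ab_group_add"
  unfolding absM_def by (simp add: minus_less_iff)

lemma absM_0 [simp]: "absM 0 = 0"
  unfolding absM_def by simp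

lemma absM_minus_commute: "absM (x - y) = absM (y - x)" for x :: "'a::linordered_ab_group_add"
  unfolding absM_def by (simp add: max.commute)

lemma absM_diff_less_iff: "absM (x - y) < d \<longleftrightarrow> x < y + d \<and> y < x + d" for x :: "'a::linordered_ab_group_add"
  unfolding absM_less_iff by (simp add: algebra_simps minus_less_iff less_diff_eq diff_less_eq)

lemma absM_triangle: "absM (x - y) < a \<Longrightarrow> absM (y - z) < b \<Longrightarrow> absM (x - z) < a + b"
  for x :: "'a::linordered_ab_group_add"
  unfolding absM_less_iff
  using add_strict_mono[of "x - y" a "y - z" b] add_strict_mono[of "- a" "x - y" "- b" "y - z"]
  by (simp add: algebra_simps)

lemma absM_nonneg: "0 \<le> absM x" for x :: "'a::linordered_ab_group_add"
  unfolding absM_def by (metis linear max.coboundedI1 max.coboundedI2 neg_0_le_iff_le)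

lemma close_to_length: "close_to d x y \<Longrightarrow> length x = length y"
  unfolding close_to_def by blast

lemma close_to_refl: "0 < d \<Longrightarrow> close_to d x x"
  unfolding close_to_def by simp

lemma close_to_sym: "close_to d x y \<Longrightarrow> close_to d y x"
  unfolding close_to_def by (simp add: absM_minus_commute)

lemma close_to_triangle: "close_to a x y \<Longrightarrow> close_to b y z \<Longrightarrow> close_to (a + b) x z"
  unfolding close_to_def using absM_triangle by fastforce

lemma close_to_mono: "close_to a x y \<Longrightarrow> a \<le> b \<Longrightarrow> close_to b x y"
  unfolding close_to_def by (meson order.strict_trans2)

lemma close_to_Cons: "close_to d (t # u) (s # v) \<longleftrightarrow> absM (t - s) < d \<and> close_to d u v"
  unfolding close_to_def by (auto simp: nth_Cons less_Suc_eq_0_disj)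

lemma close_to_ConsE:
  assumes "close_to d (t # u) z" obtains s v where "z = s # v" "absM (t - s) < d" "close_to d u v"
  using assms by (metis close_to_Cons close_to_length length_Suc_conv)

section \<open>One variable\<close>

text \<open>Density and the existence of a positive element are assumed here because any
  discontinuity forces both, as \<open>discontinuous_imp_dense\<close> shows.\<close>

locale tame_structure = ordered_structure F R
  for F :: "'f \<Rightarrow> 'a::linordered_ab_group_add list \<Rightarrow> 'a" and R :: "'r \<Rightarrow> 'a list \<Rightarrow> bool" +
  assumes complete: "definably_complete F R"
    and lomin: "locally_o_minimal F R"
    and dense_pos: "0 < (a::'a) \<Longrightarrow> \<exists>b. 0 < b \<and> b < a"
    and pos_ex: "\<exists>a::'a. 0 < a"
begin

lemma dense_ex: "(a::'a) < b \<Longrightarrow> \<exists>c. a < c \<and> c < b"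
  using dense_pos[of "b - a"] by (metis add_less_cancel_left add.right_neutral add_diff_cancel_left' diff_add_cancel
      add.commute diff_gt_0_iff_gt)

lemma gt_ex: "\<exists>b. (a::'a) < b"
  using pos_ex by (metis less_add_same_cancel1)

text \<open>Replaces division by two, which an ordered group need not allow: cut \<open>a\<close> at
  some \<open>b\<close> and take \<open>h\<close> below both pieces.\<close>

lemma half_ex: "0 < (a::'a) \<Longrightarrow> \<exists>h. 0 < h \<and> h + h < a"
proof -
  assume "0 < a"
  then obtain b where b: "0 < b" "b < a" using dense_pos by blast
  then obtain h where h: "0 < h" "h < min b (a - b)" using dense_pos[of "min b (a - b)"] by auto
  then have "h + h < b + (a - b)" by (intro add_strict_mono) auto
  then show ?thesis using h by auto
qed

lemma lub_ex:
  assumes "def_s A" "A x" "\<And>x. A x \<Longrightarrow> x \<le> b"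
  shows "\<exists>s. (\<forall>x. A x \<longrightarrow> x \<le> s) \<and> (\<forall>b. (\<forall>x. A x \<longrightarrow> x \<le> b) \<longrightarrow> s \<le> b)"
proof -
  have "definable1 F R {x. A x}"
    by (rule dpred_imp_definable1) (rule def_sD[OF assms(1) dterm_var])
  then show ?thesis using complete assms(2,3) unfolding definably_complete_def
    by (metis (no_types, lifting) empty_iff mem_Collect_eq)
qed

lemma glb_ex:
  assumes "def_s A" "A x" "\<And>x. A x \<Longrightarrow> b \<le> x"
  shows "\<exists>s. (\<forall>x. A x \<longrightarrow> s \<le> x) \<and> (\<forall>b. (\<forall>x. A x \<longrightarrow> b \<le> x) \<longrightarrow> b \<le> s)"
proof -
  have "definable1 F R {x. A x}"
    by (rule dpred_imp_definable1) (rule def_sD[OF assms(1) dterm_var])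
  then show ?thesis using complete assms(2,3) unfolding definably_complete_def
    by (metis (no_types, lifting) empty_iff mem_Collect_eq)
qed

text \<open>Points and open intervals have a constant germ to the right of \<open>a\<close>, and
  this property passes to finite unions. Local o-minimality presents a definable set near
  \<open>a\<close> as such a union.\<close>

lemma germ_right:
  assumes "def_s A"
  shows "(\<exists>v>a. \<forall>x. a < x \<and> x < v \<longrightarrow> A x) \<or> (\<exists>v>a. \<forall>x. a < x \<and> x < v \<longrightarrow> \<not> A x)"
proof -
  define decided where "decided S \<longleftrightarrow>
    (\<exists>v>a. (\<forall>x. a < x \<and> x < v \<longrightarrow> x \<in> S) \<or> (\<forall>x. a < x \<and> x < v \<longrightarrow> x \<notin> S))" for S
  have un: "decided (S \<union> T)" if S: "decided S" and T: "decided T" for S T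
  proof -
    obtain v where v: "a < v" "(\<forall>x. a < x \<and> x < v \<longrightarrow> x \<in> S) \<or> (\<forall>x. a < x \<and> x < v \<longrightarrow> x \<notin> S)"
      using S unfolding decided_def by blast
    obtain w where w: "a < w" "(\<forall>x. a < x \<and> x < w \<longrightarrow> x \<in> T) \<or> (\<forall>x. a < x \<and> x < w \<longrightarrow> x \<notin> T)"
      using T unfolding decided_def by blast
    show ?thesis unfolding decided_def
      by (rule exI[of _ "min v w"]) (use v w in auto)
  qed
  have point: "decided {c}" for c
    unfolding decided_def
    by (rule exI[of _ "if a < c then c else SOME v. a < v"]) (auto simp: someI_ex[OF gt_ex])
  have interval: "decided {c<..<d}" for c d
  proof (cases "a < c")
    case True then show ?thesis unfolding decided_def by (intro exI[of _ c]) auto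
  next
    case False then show ?thesis unfolding decided_def
      by (intro exI[of _ "if a < d then d else SOME v. a < v"]) (auto simp: someI_ex[OF gt_ex])
  qed
  have empty: "decided {}" using gt_ex[of a] unfolding decided_def by auto
  have fin: "decided S" if "finite S" for S
    using that by induction (use un[OF point] empty in auto)
  have ints: "decided (\<Union>(a, b)\<in>I. {a<..<b})" if "finite I" for I
    using that by induction (use un[OF interval] empty in auto)
  have "definable1 F R {x. A x}"
    by (rule dpred_imp_definable1) (rule def_sD[OF assms(1) dterm_var])
  then obtain u v where v: "u < a" "a < v" "finite_union_points_intervals ({x. A x} \<inter> {u<..<v})"
    using lomin unfolding locally_o_minimal_def by blast
  then have "decided ({x. A x} \<inter> {u<..<v})"
    unfolding finite_union_points_intervals_def using un fin ints by auto
  then obtain w where w: "a < w" "(\<forall>x. a < x \<and> x < w \<longrightarrow> x \<in> {x. A x} \<inter> {u<..<v}) \<or>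
       (\<forall>x. a < x \<and> x < w \<longrightarrow> x \<notin> {x. A x} \<inter> {u<..<v})"
    unfolding decided_def by blast
  show ?thesis
    using w(2) by (elim disjE; intro disjI1[OF exI[of _ "min w v"]] disjI2[OF exI[of _ "min w v"]])
     (use w(1) v in \<open>auto\<close>)
qed

section \<open>Uniformity, monotonicity and continuity on intervals\<close>

lemma interval_split:
  assumes "def_s A" "a < b"
  shows "\<exists>v. a < v \<and> v \<le> b \<and> ((\<forall>x. a < x \<and> x < v \<longrightarrow> A x) \<or> (\<forall>x. a < x \<and> x < v \<longrightarrow> \<not> A x))"
proof -
  obtain v where "a < v" "(\<forall>x. a < x \<and> x < v \<longrightarrow> A x) \<or> (\<forall>x. a < x \<and> x < v \<longrightarrow> \<not> A x)"
    using germ_right[OF assms(1), of a] by blast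
  then show ?thesis using assms(2) by (intro exI[of _ "min v b"]) auto
qed

text \<open>A Baire-type argument. If no subinterval has a uniform radius, every fixed
  \<open>r\<close> fails immediately to the right of each point. Then points that are the first to
  admit some radius (\<open>H\<close>) accumulate at \<open>a\<close>, and so fill an interval
  starting at \<open>a\<close>. Along it the admissible radii can only grow, so a radius admissible
  at one point works everywhere to its right.\<close>

lemma uniform_radius:
  assumes Q: "def_ss Q" and "a < b"
    and anti: "\<And>x r s. Q x r \<Longrightarrow> 0 < s \<Longrightarrow> s \<le> r \<Longrightarrow> Q x s"
    and ex: "\<And>x. a < x \<Longrightarrow> x < b \<Longrightarrow> \<exists>r>0. Q x r"
  shows "\<exists>a' b' r. a \<le> a' \<and> a' < b' \<and> b' \<le> b \<and> 0 < r \<and> (\<forall>x. a' < x \<and> x < b' \<longrightarrow> Q x r)"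
proof (rule ccontr)
  assume neg: "\<not> ?thesis"
  have germ: "\<exists>v. c < v \<and> v \<le> b \<and> (\<forall>x. c < x \<and> x < v \<longrightarrow> \<not> Q x r)" if "a \<le> c" "c < b" "0 < r" for c r
  proof -
    have "def_s (\<lambda>x. Q x r)" by (intro def_sI def_ssD[OF Q] definability_intros)
    from interval_split[OF this \<open>c < b\<close>] show ?thesis using neg that by blast
  qed
  define H where "H x \<longleftrightarrow> (\<exists>r. 0 < r \<and> Q x r \<and> (\<forall>y. a < y \<and> y < x \<longrightarrow> \<not> Q y r))" for x
  have Hex: "\<exists>z. H z \<and> a < z \<and> z \<le> x0" if x0: "a < x0" "x0 < b" for x0
  proof -
    obtain r where r: "0 < r" "Q x0 r" using ex x0 by blast
    define A where "A x \<longleftrightarrow> a < x \<and> x \<le> x0 \<and> Q x r" for x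
    have A: "A x0" "\<And>x. A x \<Longrightarrow> a \<le> x" using r x0 unfolding A_def by auto
    have "def_s A" unfolding A_def by (intro def_sI def_ssD[OF Q] definability_intros)
    then obtain z where z: "\<And>x. A x \<Longrightarrow> z \<le> x" "\<And>b. (\<And>x. A x \<Longrightarrow> b \<le> x) \<Longrightarrow> b \<le> z"
      using glb_ex[of A x0 a] A(1,2) by blast
    have "z \<le> x0" using z(1) r that by (auto simp: A_def)
    obtain v where v: "a < v" "\<And>x. a < x \<Longrightarrow> x < v \<Longrightarrow> \<not> Q x r"
      using germ[of a r] \<open>a < b\<close> r by auto
    have "v \<le> z" by (rule z(2)) (use v in \<open>auto simp: A_def not_less[symmetric]\<close>)
    then have "a < z" using v by simp
    have "z < b" using \<open>z \<le> x0\<close> x0 by simp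
    \<comment> \<open>The infimum is attained: otherwise the failure of \<open>r\<close> immediately
      to the right of \<open>z\<close> leaves a gap, and a larger lower bound.\<close>
    have "Q z r"
    proof (rule ccontr)
      assume nz: "\<not> Q z r"
      obtain w where w: "z < w" "\<And>x. z < x \<Longrightarrow> x < w \<Longrightarrow> \<not> Q x r"
        using germ[of z r, OF less_imp_le[OF \<open>a < z\<close>] \<open>z < b\<close> r(1)] by blast
      have "w \<le> x" if "A x" for x
        using z(1)[OF that] that w(2)[of x] nz unfolding A_def
        by (metis order.not_eq_order_implies_strict not_less)
      then have "w \<le> z" by (rule z(2))
      then show False using w by simp
    qed
    moreover have "\<not> Q y r" if "a < y" "y < z" for y
      using z(1)[of y] that \<open>z \<le> x0\<close> unfolding A_def by (meson less_imp_le less_le_trans not_less)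
    ultimately show ?thesis using r(1) \<open>a < z\<close> \<open>z \<le> x0\<close> unfolding H_def by blast
  qed
  have "def_s H" unfolding H_def by (intro def_sI def_ssD[OF Q] definability_intros)
  then obtain v where v: "a < v" "v \<le> b"
    "(\<forall>x. a < x \<and> x < v \<longrightarrow> H x) \<or> (\<forall>x. a < x \<and> x < v \<longrightarrow> \<not> H x)"
    using interval_split[of H a b] \<open>a < b\<close> by blast
  obtain y where y: "a < y" "y < v" using dense_ex v by blast
  \<comment> \<open>By \<open>Hex\<close> there are points of \<open>H\<close> arbitrarily close to
    \<open>a\<close>, which excludes the second alternative for \<open>v\<close>.\<close>
  have H: "H x" if "a < x" "x < v" for x
    using v(3) Hex[of y] y v(2) that by (meson order.strict_trans1 order.strict_trans2)
  obtain r where r: "0 < r" "Q y r" using H[OF y] unfolding H_def by blast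
  have "Q x r" if x: "y < x" "x < v" for x
  proof -
    obtain s where s: "0 < s" "Q x s" "\<not> Q y s" using H[of x] x y unfolding H_def by fastforce
    then have "r \<le> s" using anti[OF r(2), of s] by (metis linear)
    then show ?thesis using anti[OF s(2)] r by blast
  qed
  then show False using neg r y v by (metis order.strict_implies_order)
qed

definition inc_on :: "('a \<Rightarrow> 'a) \<Rightarrow> 'a \<Rightarrow> 'a \<Rightarrow> bool" where
  "inc_on h a b \<longleftrightarrow> (\<forall>x y. a < x \<and> x < y \<and> y < b \<longrightarrow> h x \<le> h y)"

text \<open>\<open>uniform_radius\<close> gives all the right neighbourhoods a common width; on an
  interval no longer than this width any two points are comparable.\<close>

lemma inc_on_subinterval_aux:
  assumes h: "def_f1 h" and "a < b"
    and ex: "\<And>x. a < x \<Longrightarrow> x < b \<Longrightarrow> \<exists>v>x. \<forall>y. x < y \<and> y < v \<longrightarrow> h x \<le> h y"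
  shows "\<exists>a' b'. a \<le> a' \<and> a' < b' \<and> b' \<le> b \<and> inc_on h a' b'"
proof -
  define Q where "Q x r \<longleftrightarrow> (\<forall>y. x < y \<and> y < x + r \<longrightarrow> h x \<le> h y)" for x r
  have "def_ss Q" unfolding Q_def by (intro def_ssI def_f1D[OF h] definability_intros)
  moreover have "Q x s" if "Q x r" "0 < s" "s \<le> r" for x r s
    using that unfolding Q_def by (meson add_left_mono order.strict_trans2)
  moreover have "\<exists>r>0. Q x r" if x: "a < x" "x < b" for x
  proof -
    obtain v where "v > x" "\<forall>y. x < y \<and> y < v \<longrightarrow> h x \<le> h y" using ex x by blast
    then show ?thesis unfolding Q_def by (intro exI[of _ "v - x"]) auto
  qed
  ultimately obtain a' b' r where *: "a \<le> a'" "a' < b'" "b' \<le> b" "0 < r" "\<And>x. a' < x \<Longrightarrow> x < b' \<Longrightarrow> Q x r"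
    using uniform_radius[of Q a b] \<open>a < b\<close> by blast
  have "inc_on h a' (min b' (a' + r))"
    unfolding inc_on_def
  proof (intro allI impI)
    fix x y assume 1: "a' < x \<and> x < y \<and> y < min b' (a' + r)"
    then have "Q x r" using * by auto
    moreover have "y < x + r" using 1 by (meson add_strict_right_mono min_less_iff_conj order.strict_trans)
    ultimately show "h x \<le> h y" using 1 unfolding Q_def by blast
  qed
  then show ?thesis using * by - (rule exI[of _ a'], rule exI[of _ "min b' (a' + r)"], auto intro: min.coboundedI1)
qed

lemma def_f1_uminus: "def_f1 h \<Longrightarrow> def_f1 (\<lambda>x. - h x)"
  unfolding def_f1_def using dterm_uminus by blast

text \<open>Immediately to the right of \<open>x\<close>, by \<open>germ_right\<close>, the values
  are either all at least \<open>h x\<close> or all below it. Which case occurs is again a definable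
  condition on \<open>x\<close>, hence constant on a subinterval.\<close>

lemma monotone_subinterval:
  assumes h: "def_f1 h" and "a < b"
  shows "\<exists>a' b'. a \<le> a' \<and> a' < b' \<and> b' \<le> b \<and> (inc_on h a' b' \<or> inc_on (\<lambda>x. - h x) a' b')"
proof -
  define G where "G x \<longleftrightarrow> (\<exists>v>x. \<forall>y. x < y \<and> y < v \<longrightarrow> h x \<le> h y)" for x
  have "def_s G" unfolding G_def by (intro def_sI def_f1D[OF h] definability_intros)
  then obtain v where v: "a < v" "v \<le> b" "(\<forall>x. a < x \<and> x < v \<longrightarrow> G x) \<or> (\<forall>x. a < x \<and> x < v \<longrightarrow> \<not> G x)"
    using interval_split \<open>a < b\<close> by blast
  have neg: "\<exists>v>x. \<forall>y. x < y \<and> y < v \<longrightarrow> - h x \<le> - h y" if "\<not> G x" for x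
  proof -
    have "def_s (\<lambda>y. h x \<le> h y)" by (intro def_sI def_f1D[OF h] definability_intros)
    from germ_right[OF this, of x] show ?thesis using that unfolding G_def
      by (metis linear neg_le_iff_le)
  qed
  show ?thesis
  proof (cases "\<forall>x. a < x \<and> x < v \<longrightarrow> G x")
    case True
    then obtain a' b' where "a \<le> a' \<and> a' < b' \<and> b' \<le> v \<and> inc_on h a' b'"
      using inc_on_subinterval_aux[OF h v(1)] unfolding G_def by blast
    then show ?thesis using v by (meson order.trans)
  next
    case False
    then obtain a' b' where "a \<le> a' \<and> a' < b' \<and> b' \<le> v \<and> inc_on (\<lambda>x. - h x) a' b'"
      using inc_on_subinterval_aux[OF def_f1_uminus[OF h] v(1)] neg v by blast
    then show ?thesis using v by (meson order.trans)
  qed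
qed

definition cont1 :: "('a \<Rightarrow> 'a) \<Rightarrow> 'a \<Rightarrow> bool" where
  "cont1 h x \<longleftrightarrow> (\<forall>\<epsilon>>0. \<exists>u v. u < x \<and> x < v \<and> (\<forall>y. u < y \<and> y < v \<longrightarrow> absM (h x - h y) < \<epsilon>))"

text \<open>If continuity failed everywhere, \<open>uniform_radius\<close> would give an interval on
  which every point has oscillation at least one fixed \<open>r\<close>. Monotonicity then separates
  any two values by \<open>r\<close>, so that \<open>s - r\<close> still bounds a set of values with
  supremum \<open>s\<close>.\<close>

lemma inc_on_cont1:
  assumes h: "def_f1 h" and "a < b" and inc: "inc_on h a b"
  shows "\<exists>x. a < x \<and> x < b \<and> cont1 h x"
proof (rule ccontr)
  assume neg: "\<not> ?thesis"
  define Q where "Q x r \<longleftrightarrow> \<not> (\<exists>u v. u < x \<and> x < v \<and> (\<forall>y. u < y \<and> y < v \<longrightarrow> absM (h x - h y) < r))" for x r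
  have "def_ss Q" unfolding Q_def by (intro def_ssI def_f1D[OF h] definability_intros)
  moreover have "Q x s" if "Q x r" "0 < s" "s \<le> r" for x r s
    using that unfolding Q_def by (meson order.strict_trans2)
  moreover have "\<exists>r>0. Q x r" if "a < x" "x < b" for x
    using neg that unfolding Q_def cont1_def by blast
  ultimately obtain a' b' r where *: "a \<le> a'" "a' < b'" "b' \<le> b" "0 < r" "\<And>x. a' < x \<Longrightarrow> x < b' \<Longrightarrow> Q x r"
    using uniform_radius[of Q a b] \<open>a < b\<close> by blast
  have mono: "h x \<le> h y" if "a' < x" "x \<le> y" "y < b'" for x y
    using inc that * unfolding inc_on_def
    by (metis order.order_iff_strict order.strict_trans1 order.strict_trans2)
  have jump: "h x + r \<le> h y" if xy: "a' < x" "x < y" "y < b'" for x y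
  proof -
    obtain z where z: "x < z" "z < y" using dense_ex xy by blast
    then have "Q z r" using * xy by (meson order.strict_trans)
    then obtain w where w: "x < w" "w < y" "\<not> absM (h z - h w) < r" unfolding Q_def using z by blast
    then have "h w + r \<le> h z \<or> h z + r \<le> h w" unfolding absM_diff_less_iff by auto
    moreover have "h x \<le> h z" "h x \<le> h w" "h z \<le> h y" "h w \<le> h y"
      using mono xy z w by (meson order.strict_trans order.strict_implies_order)+
    ultimately show ?thesis by (meson add_right_mono order.trans)
  qed
  obtain x where x: "a' < x" "x < b'" using dense_ex * by blast
  obtain y where y: "x < y" "y < b'" using dense_ex x by blast
  define A where "A s \<longleftrightarrow> (\<exists>z. x < z \<and> z < y \<and> s = h z)" for s
  have "def_s A" unfolding A_def by (intro def_sI def_f1D[OF h] definability_intros)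
  moreover obtain z0 where "x < z0" "z0 < y" using dense_ex y by blast
  then have "A (h z0)" unfolding A_def by blast
  moreover have "s \<le> h y" if "A s" for s
    using that mono x y unfolding A_def by (meson order.strict_trans order.strict_implies_order)
  ultimately obtain s where s: "\<And>t. A t \<Longrightarrow> t \<le> s" "\<And>b. (\<And>t. A t \<Longrightarrow> t \<le> b) \<Longrightarrow> s \<le> b"
    using lub_ex[of A "h z0" "h y"] by blast
  have "t \<le> s - r" if t: "A t" for t
  proof -
    obtain z where z: "x < z" "z < y" "t = h z" using t unfolding A_def by blast
    obtain z' where z': "z < z'" "z' < y" using dense_ex z by blast
    then have "A (h z')" unfolding A_def using z by (intro exI[of _ z']) auto
    then show ?thesis using s(1) jump[of z z'] z z' x y
      by (metis add.commute le_diff_eq order.strict_trans order.trans)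
  qed
  then have "s \<le> s - r" by (rule s(2))
  then show False using \<open>0 < r\<close> by (simp add: le_diff_eq)
qed

end

section \<open>Generic continuity in several variables\<close>

context ordered_structure begin

lemma dpred_Ball_list: "(\<And>x. x \<in> set xs \<Longrightarrow> dpred (P x)) \<Longrightarrow> dpred (\<lambda>e. \<forall>x\<in>set xs. P x e)"
  by (induction xs) (auto intro: dpred_and dpred_const)

lemma dterm_nth_vars: "i < d \<Longrightarrow> dterm (\<lambda>e. map (\<lambda>j. e (r j)) [0..<d] ! i)"
  by (rule dterm_nth[OF dtuple_vars])

lemmas dtuple_intros = dtuple_vars dtuple_vars[where r = "\<lambda>i. i"] dtuple_Cons dtuple_Nil dtuple_append dtuple_const

end

context tame_structure begin

text \<open>The guard \<open>length y = d\<close> gives the quantifier over \<open>y\<close> the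
  form that \<open>dpred_all_list\<close> handles.\<close>

definition cont :: "nat \<Rightarrow> ('a list \<Rightarrow> 'a) \<Rightarrow> 'a list \<Rightarrow> bool" where
  "cont d g z \<longleftrightarrow> (\<forall>\<epsilon>>0. \<exists>\<delta>>0. \<forall>y. length y = d \<longrightarrow> (close_to \<delta> z y \<longrightarrow> absM (g z - g y) < \<epsilon>))"

text \<open>The statement carried through the induction on \<open>d\<close>: a continuity point in
  every ball, that is, density of the continuity points.\<close>

definition generic_cont :: "nat \<Rightarrow> bool" where
  "generic_cont d \<longleftrightarrow> (\<forall>g c r. def_f d g \<longrightarrow> length c = d \<longrightarrow> 0 < r \<longrightarrow> (\<exists>z. close_to r c z \<and> cont d g z))"

definition subball :: "'a \<Rightarrow> 'a list \<Rightarrow> 'a \<Rightarrow> 'a list \<Rightarrow> bool" where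
  "subball r c s z \<longleftrightarrow> 0 < s \<and> (\<forall>y. close_to s z y \<longrightarrow> close_to r c y)"

lemma subball_center: "subball r c s z \<Longrightarrow> close_to r c z"
  unfolding subball_def using close_to_refl by blast

lemma subball_trans: "subball r c s z \<Longrightarrow> subball s z t y \<Longrightarrow> subball r c t y"
  unfolding subball_def by blast

lemma subball_length: "subball r c s z \<Longrightarrow> length z = length c"
  using subball_center close_to_length by metis

lemma subball_shrink: "subball r c s z \<Longrightarrow> 0 < t \<Longrightarrow> t \<le> s \<Longrightarrow> subball r c t z"
  unfolding subball_def using close_to_mono by blast

text \<open>Openness of balls, by recursion on the coordinates: the slack
  \<open>r - absM (x - y)\<close> of each coordinate bounds the radius, and the empty tuple allows
  any positive one.\<close>

lemma ball_inner: "close_to r c z \<Longrightarrow> \<exists>s. subball r c s z"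
proof -
  assume "close_to r c z"
  then have "length c = length z" by (rule close_to_length)
  then show ?thesis using \<open>close_to r c z\<close>
  proof (induction c z rule: list_induct2)
    case Nil
    then show ?case using pos_ex unfolding subball_def close_to_def by auto
  next
    case (Cons x xs y ys)
    then obtain s where s: "subball r xs s ys" by (auto simp: close_to_Cons)
    have "0 < r - absM (x - y)" using Cons by (simp add: close_to_Cons)
    then obtain h where h: "0 < h" "h < r - absM (x - y)" using dense_pos by blast
    have "absM (x - y) < r - h" using h by (simp add: less_diff_eq add.commute)
    then have *: "absM (x - w) < r" if "absM (y - w) < h" for w
      using absM_triangle[of x y "r - h" w h] that by simp
    have "subball r (x # xs) (min h s) (y # ys)"
      unfolding subball_def
    proof (intro conjI allI impI)
      show "0 < min h s" using s h unfolding subball_def by auto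
      fix w assume "close_to (min h s) (y # ys) w"
      then obtain w1 w2 where w: "w = w1 # w2" "absM (y - w1) < min h s" "close_to (min h s) ys w2"
        by (rule close_to_ConsE)
      then show "close_to r (x # xs) w"
        using * s close_to_mono[OF w(3), of s] unfolding subball_def by (simp add: close_to_Cons)
    qed
    then show ?case by blast
  qed
qed

lemma def_l_cont:
  assumes g: "def_f d g"
  shows "def_l d (cont d g)"
  unfolding cont_def by (rule def_lI, intro definability_intros def_fD[OF g]) (rule dtuple_intros)+

text \<open>The indicator function of \<open>A\<close> with values \<open>0\<close> and
  \<open>one\<close> is locally constant at a continuity point, as seen from the tolerance
  \<open>one\<close>.\<close>

lemma generic_split:
  assumes gen: "generic_cont d" and A: "def_l d A" and c: "length c = d" and r: "0 < r"
  shows "\<exists>s z. subball r c s z \<and> ((\<forall>y. close_to s z y \<longrightarrow> A y) \<or> (\<forall>y. close_to s z y \<longrightarrow> \<not> A y))"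
proof -
  obtain one :: 'a where one: "0 < one" using pos_ex by blast
  define g where "g u = (if A u then one else 0)" for u
  have "def_f d g" unfolding g_def by (rule def_fI, intro definability_intros def_lD[OF A])
  then obtain z where z: "close_to r c z" "cont d g z" using gen c r unfolding generic_cont_def by blast
  obtain \<delta> where \<delta>: "0 < \<delta>" "\<And>y. length y = d \<Longrightarrow> close_to \<delta> z y \<Longrightarrow> absM (g z - g y) < one"
    using z(2) one unfolding cont_def by blast
  obtain s where s: "subball r c s z" using ball_inner[OF z(1)] by blast
  have "A y = A z" if "close_to (min \<delta> s) z y" for y
  proof -
    have "length y = d" using that close_to_length z(1) c by metis
    then have "absM (g z - g y) < one" using \<delta>(2) close_to_mono[OF that] by simp
    then show ?thesis unfolding absM_less_iff g_def by (auto split: if_splits)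
  qed
  moreover have "subball r c (min \<delta> s) z"
    by (rule subball_shrink[OF s]) (use s \<delta> in \<open>auto simp: subball_def\<close>)
  ultimately show ?thesis by blast
qed

text \<open>By induction the common continuity points of \<open>gs\<close> meet every ball, so by
  \<open>generic_split\<close> they fill some ball; the next function has a continuity point inside
  it.\<close>

lemma generic_cont_list:
  assumes gen: "generic_cont d"
  shows "(\<And>g. g \<in> set gs \<Longrightarrow> def_f d g) \<Longrightarrow> length c = d \<Longrightarrow> 0 < r \<Longrightarrow>
    \<exists>z. close_to r c z \<and> (\<forall>g\<in>set gs. cont d g z)"
proof (induction gs arbitrary: c r)
  case Nil
  then show ?case using close_to_refl by auto
next
  case (Cons g gs)
  have "def_l d (\<lambda>z. \<forall>g\<in>set gs. cont d g z)"
    using Cons.prems by (intro def_lI dpred_Ball_list def_lD[OF def_l_cont] dtuple_vars[where r = "\<lambda>i. i"]) auto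
  from generic_split[OF gen this Cons.prems(2,3)] obtain s z where s: "subball r c s z"
    "(\<forall>y. close_to s z y \<longrightarrow> (\<forall>g\<in>set gs. cont d g y)) \<or> (\<forall>y. close_to s z y \<longrightarrow> \<not> (\<forall>g\<in>set gs. cont d g y))"
    by blast
  have z: "length z = d" "0 < s" using subball_length[OF s(1)] Cons.prems s(1) by (auto simp: subball_def)
  have 1: "\<forall>y. close_to s z y \<longrightarrow> (\<forall>g\<in>set gs. cont d g y)"
    using s(2) Cons.IH[of z s] Cons.prems(1) z by auto
  obtain y where "close_to s z y" "cont d g y"
    using gen Cons.prems(1)[of g] z unfolding generic_cont_def by (metis list.set_intros(1))
  then show ?case using 1 s(1) unfolding subball_def by auto
qed

section \<open>Definable choice\<close>

lemma unique_fun: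
  assumes G: "def_sl d G" and uniq: "\<And>s t u. G s u \<Longrightarrow> G t u \<Longrightarrow> s = t"
  shows "\<exists>g. def_f d g \<and> (\<forall>u. (\<exists>s. G s u) \<longrightarrow> G (g u) u)"
proof (intro exI conjI allI impI)
  \<comment> \<open>The default \<open>0\<close> makes the function total; its graph is then a
    disjunction on whether a value exists.\<close>
  let ?g = "\<lambda>u. if \<exists>s. G s u then THE s. G s u else 0"
  have the: "(THE s. G s u) = s" if "G s u" for s u using that uniq by blast
  have "dpred (\<lambda>e. G (e 0) (map (\<lambda>i. e (Suc i)) [0..<d]) \<or>
      (\<not> (\<exists>s. G s (map (\<lambda>i. e (Suc i)) [0..<d])) \<and> e 0 = 0))"
    by (intro definability_intros def_slD[OF G])
  moreover have "G x u \<or> (\<not> (\<exists>s. G s u) \<and> x = 0) \<longleftrightarrow> x = ?g u" for x u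
    using the by auto
  ultimately have "dpred (\<lambda>e. e 0 = ?g (map (\<lambda>i. e (Suc i)) [0..<d]))" by (simp only:)
  then show "def_f d ?g" by (intro def_fI) (simp add: dterm_def)
  show "G (?g u) u" if "\<exists>s. G s u" for u using that the by auto
qed

lemma inf_fun:
  assumes Y: "def_sl d Y"
  shows "\<exists>g. def_f d g \<and> (\<forall>u b. length u = d \<longrightarrow> (\<exists>t. Y t u) \<longrightarrow> (\<forall>t. Y t u \<longrightarrow> b \<le> t) \<longrightarrow>
    (\<forall>t. Y t u \<longrightarrow> g u \<le> t) \<and> (\<forall>b. (\<forall>t. Y t u \<longrightarrow> b \<le> t) \<longrightarrow> b \<le> g u))"
proof -
  define G where "G s u \<longleftrightarrow> (\<forall>t. Y t u \<longrightarrow> s \<le> t) \<and> (\<forall>b. (\<forall>t. Y t u \<longrightarrow> b \<le> t) \<longrightarrow> b \<le> s)" for s u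
  have "def_sl d G" unfolding G_def by (rule def_slI, intro definability_intros def_slD[OF Y])
  moreover have "s = t" if "G s u" "G t u" for s t u
    using that unfolding G_def by (meson order.antisym)
  ultimately obtain g where g: "def_f d g" "\<And>u. (\<exists>s. G s u) \<Longrightarrow> G (g u) u"
    using unique_fun[of d G] by blast
  have "\<exists>s. G s u" if "length u = d" "Y t u" "\<forall>t. Y t u \<longrightarrow> b \<le> t" for u b t
    unfolding G_def
    by (rule glb_ex[of "\<lambda>t. Y t u" t b]) (rule def_sI, intro definability_intros def_slD[OF Y], use that in auto)
  then have "G (g u) u" if "length u = d" "\<exists>t. Y t u" "\<forall>t. Y t u \<longrightarrow> b \<le> t" for u b
    using g(2) that by blast
  then show ?thesis using g(1) unfolding G_def by (intro exI[of _ g]) simp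
qed

lemma sup_fun:
  assumes Y: "def_sl d Y"
  shows "\<exists>g. def_f d g \<and> (\<forall>u b. length u = d \<longrightarrow> (\<exists>t. Y t u) \<longrightarrow> (\<forall>t. Y t u \<longrightarrow> t \<le> b) \<longrightarrow>
    (\<forall>t. Y t u \<longrightarrow> t \<le> g u) \<and> (\<forall>b. (\<forall>t. Y t u \<longrightarrow> t \<le> b) \<longrightarrow> g u \<le> b))"
proof -
  define G where "G s u \<longleftrightarrow> (\<forall>t. Y t u \<longrightarrow> t \<le> s) \<and> (\<forall>b. (\<forall>t. Y t u \<longrightarrow> t \<le> b) \<longrightarrow> s \<le> b)" for s u
  have "def_sl d G" unfolding G_def by (rule def_slI, intro definability_intros def_slD[OF Y])
  moreover have "s = t" if "G s u" "G t u" for s t u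
    using that unfolding G_def by (meson order.antisym)
  ultimately obtain g where g: "def_f d g" "\<And>u. (\<exists>s. G s u) \<Longrightarrow> G (g u) u"
    using unique_fun[of d G] by blast
  have "\<exists>s. G s u" if "length u = d" "Y t u" "\<forall>t. Y t u \<longrightarrow> t \<le> b" for u b t
    unfolding G_def
    by (rule lub_ex[of "\<lambda>t. Y t u" t b]) (rule def_sI, intro definability_intros def_slD[OF Y], use that in auto)
  then have "G (g u) u" if "length u = d" "\<exists>t. Y t u" "\<forall>t. Y t u \<longrightarrow> t \<le> b" for u b
    using g(2) that by blast
  then show ?thesis using g(1) unfolding G_def by (intro exI[of _ g]) simp
qed

text \<open>If the infimum \<open>i u\<close> lies in the fibre, it is chosen. Otherwise
  \<open>germ_right\<close> puts an interval \<open>(i u, i u + w)\<close> into the fibre, and a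
  point of it has to be defined without halving \<open>w\<close>. The supremum \<open>h u\<close> of
  all \<open>x\<close> with \<open>x + x\<close> at most an admissible width serves as half of the
  largest width.\<close>

lemma choice_nonneg:
  assumes Y: "def_sl d Y" and nonneg: "\<And>t u. Y t u \<Longrightarrow> 0 \<le> t"
  shows "\<exists>g. def_f d g \<and> (\<forall>u. length u = d \<longrightarrow> (\<exists>t. Y t u) \<longrightarrow> Y (g u) u)"
proof -
  obtain one :: 'a where one: "0 < one" using pos_ex by blast
  obtain i where i: "def_f d i" and inf: "\<And>u b. length u = d \<Longrightarrow> (\<exists>t. Y t u) \<Longrightarrow> (\<forall>t. Y t u \<longrightarrow> b \<le> t) \<Longrightarrow>
    (\<forall>t. Y t u \<longrightarrow> i u \<le> t) \<and> (\<forall>b. (\<forall>t. Y t u \<longrightarrow> b \<le> t) \<longrightarrow> b \<le> i u)"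
    using inf_fun[OF Y] by blast
  \<comment> \<open>The cap \<open>w \<le> one\<close> keeps the widths bounded even where the fibre
    contains everything above \<open>i u\<close>.\<close>
  define W where "W w u \<longleftrightarrow> w \<le> one \<and> (\<forall>t. i u < t \<and> t < i u + w \<longrightarrow> Y t u)" for w u
  define X where "X x u \<longleftrightarrow> (\<exists>w. x + x \<le> w \<and> W w u)" for x u
  have "def_sl d X" unfolding X_def W_def by (rule def_slI, intro definability_intros def_slD[OF Y] def_fD[OF i])
  then obtain h where h: "def_f d h" and sup: "\<And>u b. length u = d \<Longrightarrow> (\<exists>t. X t u) \<Longrightarrow> (\<forall>t. X t u \<longrightarrow> t \<le> b) \<Longrightarrow>
    (\<forall>t. X t u \<longrightarrow> t \<le> h u) \<and> (\<forall>b. (\<forall>t. X t u \<longrightarrow> t \<le> b) \<longrightarrow> h u \<le> b)"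
    using sup_fun by blast
  define g where "g u = (if Y (i u) u then i u else i u + h u)" for u
  have "def_f d g" unfolding g_def by (rule def_fI, intro definability_intros def_slD[OF Y] def_fD[OF i] def_fD[OF h])
  moreover have "Y (g u) u" if u: "length u = d" and ex: "\<exists>t. Y t u" for u
  proof (cases "Y (i u) u")
    case True then show ?thesis by (simp add: g_def)
  next
    case False
    have iu: "\<And>t. Y t u \<Longrightarrow> i u \<le> t" "\<And>b. (\<And>t. Y t u \<Longrightarrow> b \<le> t) \<Longrightarrow> b \<le> i u"
      using inf[OF u ex, of 0] nonneg by auto
    have "def_s (\<lambda>t. Y t u)" by (rule def_sI, intro definability_intros def_slD[OF Y] u)
    moreover have "\<not> (\<forall>x. i u < x \<and> x < v \<longrightarrow> \<not> Y x u)" if "i u < v" for v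
    proof
      assume *: "\<forall>x. i u < x \<and> x < v \<longrightarrow> \<not> Y x u"
      have "v \<le> i u"
      proof (rule iu(2))
        fix t assume "Y t u"
        then have "i u < t" using iu(1) False by (metis order.not_eq_order_implies_strict)
        then show "v \<le> t" using * \<open>Y t u\<close> not_less by blast
      qed
      then show False using that by simp
    qed
    ultimately obtain v where v: "i u < v" "\<forall>x. i u < x \<and> x < v \<longrightarrow> Y x u"
      using germ_right[of "\<lambda>t. Y t u" "i u"] by blast
    define w0 where "w0 = min (v - i u) one"
    have "w0 \<le> v - i u" unfolding w0_def by simp
    then have "i u + w0 \<le> v" by (simp add: le_diff_eq add.commute)
    then have w0: "0 < w0" "W w0 u" using v one unfolding w0_def W_def by auto
    obtain e where e: "0 < e" "e + e < w0" using half_ex w0 by blast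
    have bd: "x \<le> one" if "X x u" for x
    proof (rule ccontr)
      assume "\<not> x \<le> one"
      then have "one + 0 < x + x" using one by (intro add_strict_mono) auto
      moreover have "x + x \<le> one" using that unfolding X_def W_def by auto
      ultimately show False by simp
    qed
    have Xe: "X e u" unfolding X_def using e w0 by (meson less_imp_le)
    have hu: "\<And>t. X t u \<Longrightarrow> t \<le> h u" "\<And>b. (\<And>t. X t u \<Longrightarrow> t \<le> b) \<Longrightarrow> h u \<le> b"
      using sup[OF u, of one] Xe bd by blast+
    have "0 < h u" using hu(1)[OF Xe] e by simp
    \<comment> \<open>This places \<open>i u + h u\<close> inside an admissible interval. If all
      widths were at most \<open>h u\<close>, then \<open>h u - e\<close> would already bound all
      \<open>x\<close> with \<open>X x u\<close>.\<close>
    have "\<exists>w. W w u \<and> h u < w"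
    proof (rule ccontr)
      assume "\<not> ?thesis"
      then have le: "w \<le> h u" if "W w u" for w using that by (meson not_less)
      have "x \<le> h u - e" if x: "X x u" for x
      proof -
        obtain w where w: "x + x \<le> w" "W w u" using x unfolding X_def by blast
        \<comment> \<open>The larger of the two widths has room for \<open>e + e\<close> as well as
          for \<open>x + x\<close>; so \<open>w' < x + e\<close> would give
          \<open>w' + w' < (x + x) + (e + e) \<le> w' + w'\<close>.\<close>
        define w' where "w' = max w w0"
        have w': "x + x \<le> w'" "W w' u" "e + e \<le> w'"
          using w w0 e unfolding w'_def by (auto simp: max_def)
        have "x \<le> w' - e"
        proof (rule ccontr)
          assume "\<not> x \<le> w' - e"
          then have "w' < x + e" by (simp add: le_diff_eq)
          then have "w' + w' < (x + e) + (x + e)" by (intro add_strict_mono)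
          also have "\<dots> = (x + x) + (e + e)" by (simp add: algebra_simps)
          also have "\<dots> \<le> w' + w'" using w' by (intro add_mono)
          finally show False by simp
        qed
        also have "\<dots> \<le> h u - e" using le[OF w'(2)] by (rule diff_right_mono)
        finally show ?thesis .
      qed
      then have "h u \<le> h u - e" by (rule hu(2))
      then show False using e by (simp add: le_diff_eq)
    qed
    then show ?thesis using False \<open>0 < h u\<close> unfolding W_def g_def by auto
  qed
  ultimately show ?thesis by blast
qed

text \<open>Folding each fibre onto the nonnegative half-line supplies the lower bound for
  \<open>choice_nonneg\<close>; the sign is recovered by testing \<open>X (y u) u\<close>.\<close>

lemma choice:
  assumes X: "def_sl d X"
  shows "\<exists>g. def_f d g \<and> (\<forall>u. length u = d \<longrightarrow> (\<exists>t. X t u) \<longrightarrow> X (g u) u)"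
proof -
  define Y where "Y t u \<longleftrightarrow> 0 \<le> t \<and> (X t u \<or> X (- t) u)" for t u
  have nonneg: "0 \<le> t" if "Y t u" for t u using that unfolding Y_def by simp
  have "def_sl d Y" unfolding Y_def by (rule def_slI, intro definability_intros def_slD[OF X])
  then obtain y where y: "def_f d y" "\<And>u. length u = d \<Longrightarrow> (\<exists>t. Y t u) \<Longrightarrow> Y (y u) u"
    using choice_nonneg[of d Y] nonneg by blast
  have "\<exists>t. Y t u" if "X t u" for t u
    by (rule exI[of _ "if 0 \<le> t then t else - t"]) (use that in \<open>auto simp: Y_def\<close>)
  then have "X (if X (y u) u then y u else - y u) u" if "length u = d" "\<exists>t. X t u" for u
    using y(2)[of u] that unfolding Y_def by auto
  moreover have "def_f d (\<lambda>u. if X (y u) u then y u else - y u)"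
    by (rule def_fI, intro definability_intros def_slD[OF X] def_fD[OF y(1)])
  ultimately show ?thesis by blast
qed

text \<open>Coordinates are chosen one after another, each from the projection of what the earlier
  choices leave of the fibre.\<close>

lemma choice_list:
  "def_ll k d S \<Longrightarrow> \<exists>gs. length gs = k \<and> (\<forall>g\<in>set gs. def_f d g) \<and>
    (\<forall>u. length u = d \<longrightarrow> (\<exists>s. length s = k \<and> S s u) \<longrightarrow> S (map (\<lambda>g. g u) gs) u)"
proof (induction k arbitrary: S)
  case 0
  then show ?case by auto
next
  case (Suc k)
  have "def_sl d (\<lambda>t u. \<exists>s. length s = k \<and> S (t # s) u)"
    by (rule def_slI, intro definability_intros def_llD[OF Suc.prems])
  then obtain g where g: "def_f d g"
    "\<And>u. length u = d \<Longrightarrow> (\<exists>t s. length s = k \<and> S (t # s) u) \<Longrightarrow> \<exists>s. length s = k \<and> S (g u # s) u"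
    using choice[of d "\<lambda>t u. \<exists>s. length s = k \<and> S (t # s) u"] by blast
  have "def_ll k d (\<lambda>s u. S (g u # s) u)"
    by (rule def_llI, intro definability_intros def_llD[OF Suc.prems] def_fD[OF g(1)])
  from Suc.IH[OF this] obtain gs where gs: "length gs = k" "\<forall>g\<in>set gs. def_f d g"
    "\<And>u. length u = d \<Longrightarrow> (\<exists>s. length s = k \<and> S (g u # s) u) \<Longrightarrow> S (g u # map (\<lambda>g. g u) gs) u"
    by blast
  show ?case
  proof (intro exI[of _ "g # gs"] conjI allI impI)
    fix u assume u: "length u = d" "\<exists>s. length s = Suc k \<and> S s u"
    then have "\<exists>t s. length s = k \<and> S (t # s) u" by (metis length_Suc_conv)
    then show "S (map (\<lambda>g. g u) (g # gs)) u" using gs(3) g(2) u(1) by simp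
  qed (use gs g in auto)
qed

section \<open>Lower semicontinuous families and uniform intervals\<close>

lemma finite_min_radius:
  assumes "\<And>g. g \<in> set gs \<Longrightarrow> \<exists>\<delta>>0. \<forall>u. close_to \<delta> z u \<longrightarrow> P g u"
  shows "\<exists>\<delta>>0. \<forall>u. close_to \<delta> z u \<longrightarrow> (\<forall>g\<in>set gs. P g (u :: 'a list))"
  using assms
proof (induction gs)
  case Nil
  then show ?case using pos_ex by auto
next
  case (Cons g gs)
  obtain \<delta>1 where 1: "0 < \<delta>1" "\<forall>u. close_to \<delta>1 z u \<longrightarrow> (\<forall>g\<in>set gs. P g u)"
    using Cons.IH Cons.prems by auto
  obtain \<delta>2 where 2: "0 < \<delta>2" "\<forall>u. close_to \<delta>2 z u \<longrightarrow> P g u"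
    using Cons.prems[of g] by auto
  show ?case
    by (rule exI[of _ "min \<delta>1 \<delta>2"]) (use 1 2 close_to_mono[of "min \<delta>1 \<delta>2" z] in auto)
qed

text \<open>A common continuity point of the components of a definable section has the required property.\<close>

lemma lsc_point:
  assumes gen: "generic_cont d" and S: "def_ll k d S" and c: "length c = d" "0 < r"
    and ex: "\<And>u. close_to r c u \<Longrightarrow> \<exists>s. length s = k \<and> S s u"
  shows "\<exists>u0 s0. close_to r c u0 \<and> length s0 = k \<and> S s0 u0 \<and>
    (\<forall>\<epsilon>>0. \<exists>\<delta>. subball r c \<delta> u0 \<and> (\<forall>u. close_to \<delta> u0 u \<longrightarrow> (\<exists>s. S s u \<and> close_to \<epsilon> s0 s)))"
proof -
  obtain gs where gs: "length gs = k" "\<And>g. g \<in> set gs \<Longrightarrow> def_f d g"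
    "\<And>u. length u = d \<Longrightarrow> (\<exists>s. length s = k \<and> S s u) \<Longrightarrow> S (map (\<lambda>g. g u) gs) u"
    using choice_list[OF S] by blast
  obtain u0 where u0: "close_to r c u0" "\<forall>g\<in>set gs. cont d g u0"
    using generic_cont_list[OF gen gs(2) c] by blast
  have sec: "S (map (\<lambda>g. g u) gs) u" if "close_to r c u" for u
    using gs(3) ex[OF that] close_to_length[OF that] c by simp
  obtain \<delta>0 where \<delta>0: "subball r c \<delta>0 u0" using ball_inner[OF u0(1)] by blast
  have "\<exists>\<delta>. subball r c \<delta> u0 \<and> (\<forall>u. close_to \<delta> u0 u \<longrightarrow> (\<exists>s. S s u \<and> close_to \<epsilon> (map (\<lambda>g. g u0) gs) s))"
    if "0 < \<epsilon>" for \<epsilon>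
  proof -
    have "\<exists>\<delta>>0. \<forall>u. close_to \<delta> u0 u \<longrightarrow> absM (g u0 - g u) < \<epsilon>" if "g \<in> set gs" for g
      using u0 \<open>0 < \<epsilon>\<close> that c close_to_length unfolding cont_def by metis
    from finite_min_radius[of gs u0 "\<lambda>g u. absM (g u0 - g u) < \<epsilon>", OF this]
    obtain \<delta> where \<delta>: "0 < \<delta>" "\<And>u g. close_to \<delta> u0 u \<Longrightarrow> g \<in> set gs \<Longrightarrow> absM (g u0 - g u) < \<epsilon>"
      by blast
    have "subball r c (min \<delta> \<delta>0) u0"
      by (rule subball_shrink[OF \<delta>0]) (use \<delta>0 \<delta> in \<open>auto simp: subball_def\<close>)
    moreover have "S (map (\<lambda>g. g u) gs) u \<and> close_to \<epsilon> (map (\<lambda>g. g u0) gs) (map (\<lambda>g. g u) gs)"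
      if "close_to (min \<delta> \<delta>0) u0 u" for u
    proof
      show "S (map (\<lambda>g. g u) gs) u"
        using calculation that sec unfolding subball_def by blast
      show "close_to \<epsilon> (map (\<lambda>g. g u0) gs) (map (\<lambda>g. g u) gs)"
        using \<delta>(2)[OF close_to_mono[OF that]] unfolding close_to_def by simp
    qed
    ultimately show ?thesis by blast
  qed
  then show ?thesis using u0(1) sec[OF u0(1)] gs(1)
    by (intro exI[of _ u0] exI[of _ "map (\<lambda>g. g u0) gs"]) simp
qed

text \<open>An interval is coded by its pair of endpoints. At a point of lower semicontinuity the
  endpoints over nearby \<open>u\<close> move by less than \<open>h\<close>, so the interval over
  \<open>u0\<close>, shortened by \<open>h\<close> at both ends, lies in all the nearby ones and
  inherits \<open>I\<close> by \<open>hered\<close>.\<close>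

lemma uniform_interval:
  assumes gen: "generic_cont d" and I: "def_ll 2 d (\<lambda>s. I (s ! 0) (s ! 1))" and c: "length c = d" "0 < r"
    and ex: "\<And>u. close_to r c u \<Longrightarrow> \<exists>a b. a < b \<and> I a b u"
    and hered: "\<And>a b a' b' u. I a b u \<Longrightarrow> a \<le> a' \<Longrightarrow> b' \<le> b \<Longrightarrow> I a' b' u"
  shows "\<exists>s z a b. subball r c s z \<and> a < b \<and> (\<forall>u. close_to s z u \<longrightarrow> I a b u)"
proof -
  define S where "S s u \<longleftrightarrow> s ! 0 < s ! 1 \<and> I (s ! 0) (s ! 1) u" for s u
  have "def_ll 2 d S"
    unfolding S_def by (rule def_llI, intro definability_intros def_llD[OF I] dterm_nth_vars dterm_nth_vars[where r = "\<lambda>i. i"]) simp_all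
  moreover have "\<exists>s. length s = 2 \<and> S s u" if u: "close_to r c u" for u
  proof -
    obtain a b where "a < b" "I a b u" using ex[OF u] by blast
    then show ?thesis unfolding S_def by (intro exI[of _ "[a, b]"]) auto
  qed
  ultimately obtain u0 s0 where s0: "length s0 = 2" "S s0 u0"
    "\<And>\<epsilon>. 0 < \<epsilon> \<Longrightarrow> \<exists>\<delta>. subball r c \<delta> u0 \<and> (\<forall>u. close_to \<delta> u0 u \<longrightarrow> (\<exists>s. S s u \<and> close_to \<epsilon> s0 s))"
    using lsc_point[OF gen _ c, of 2 S] by blast
  have "0 < s0 ! 1 - s0 ! 0" using s0 unfolding S_def by simp
  then obtain h where h: "0 < h" "h + h < s0 ! 1 - s0 ! 0" using half_ex by blast
  obtain \<delta> where \<delta>: "subball r c \<delta> u0" "\<And>u. close_to \<delta> u0 u \<Longrightarrow> \<exists>s. S s u \<and> close_to h s0 s"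
    using s0(3)[OF h(1)] by blast
  have "I (s0 ! 0 + h) (s0 ! 1 - h) u" if u: "close_to \<delta> u0 u" for u
  proof -
    obtain s where s: "S s u" "close_to h s0 s" using \<delta>(2) u by blast
    then have "absM (s0 ! 0 - s ! 0) < h" "absM (s0 ! 1 - s ! 1) < h"
      using s0(1) unfolding close_to_def by auto
    then have "s ! 0 \<le> s0 ! 0 + h" "s0 ! 1 - h \<le> s ! 1"
      unfolding absM_diff_less_iff by (auto simp: diff_le_eq)
    then show ?thesis using s(1) hered unfolding S_def by blast
  qed
  moreover have "s0 ! 0 + h < s0 ! 1 - h" using h(2) by (simp add: algebra_simps less_diff_eq)
  ultimately show ?thesis using \<delta>(1) by blast
qed

text \<open>Three steps: an interval on which \<open>g\<close> increases in its first variable for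
  all \<open>u\<close> of a ball; a \<open>u0\<close> at which \<open>g (t # u)\<close> is
  continuous in \<open>u\<close> for every \<open>t\<close> of a subinterval; a continuity point
  \<open>t1\<close> of the slice over \<open>u0\<close>. Monotonicity then upgrades the two separate
  continuities to joint continuity at \<open>t1 # u0\<close>.\<close>

lemma generic_cont_Suc_aux:
  assumes gen: "generic_cont d" and g: "def_f (Suc d) g" and c: "length c = d" "0 < r"
    and ex: "\<And>u. close_to r c u \<Longrightarrow> \<exists>a b. lo \<le> a \<and> a < b \<and> b \<le> hi \<and> inc_on (\<lambda>t. g (t # u)) a b"
  shows "\<exists>t u. lo < t \<and> t < hi \<and> close_to r c u \<and> cont (Suc d) g (t # u)"
proof -
  define I where "I a b u \<longleftrightarrow> lo \<le> a \<and> b \<le> hi \<and> inc_on (\<lambda>t. g (t # u)) a b" for a b u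
  have "def_ll 2 d (\<lambda>s. I (s ! 0) (s ! 1))"
    unfolding I_def inc_on_def
    by (rule def_llI, intro definability_intros def_fD[OF g] dterm_nth_vars dterm_nth_vars[where r = "\<lambda>i. i"]) simp_all
  moreover have "\<exists>a b. a < b \<and> I a b u" if "close_to r c u" for u
    using ex[OF that] unfolding I_def by blast
  moreover have "I a' b' u" if "I a b u" "a \<le> a'" "b' \<le> b" for a b a' b' u
    using that unfolding I_def inc_on_def by (meson order.trans order.strict_trans1 order.strict_trans2)
  ultimately obtain s z a b where sz: "subball r c s z" "a < b" "\<And>u. close_to s z u \<Longrightarrow> I a b u"
    using uniform_interval[OF gen _ c, of I] by blast
  have z: "length z = d" "0 < s" using subball_length[OF sz(1)] c sz(1) by (auto simp: subball_def)
  have lohi: "lo \<le> a" "b \<le> hi" using sz(3)[OF close_to_refl[OF z(2)]] unfolding I_def by auto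
  have inc: "g (t # u) \<le> g (t' # u)" if "close_to s z u" "a < t" "t < t'" "t' < b" for t t' u
    using sz(3)[OF that(1)] that unfolding I_def inc_on_def by blast
  define K where "K t u \<longleftrightarrow> cont d (\<lambda>u. g (t # u)) u" for t u
  have K: "def_sl d K"
    unfolding K_def cont_def by (rule def_slI, intro definability_intros def_fD[OF g]) (rule dtuple_intros)+
  have "\<exists>u0 a' b'. close_to s z u0 \<and> a \<le> a' \<and> a' < b' \<and> b' \<le> b \<and> (\<forall>t. a' < t \<and> t < b' \<longrightarrow> K t u0)"
  proof (rule ccontr)
    assume neg: "\<not> ?thesis"
    \<comment> \<open>Otherwise \<open>(a, b)\<close> contains, for each \<open>u\<close> of the
      ball, an interval of \<open>t\<close> at which continuity in \<open>u\<close> fails, and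
      \<open>uniform_interval\<close> makes it common to a smaller ball. For a single such
      \<open>t\<close>, generic continuity in \<open>d\<close> variables is contradicted.\<close>
    define J where "J a' b' u \<longleftrightarrow> a \<le> a' \<and> b' \<le> b \<and> (\<forall>t. a' < t \<and> t < b' \<longrightarrow> \<not> K t u)" for a' b' u
    have "def_ll 2 d (\<lambda>s. J (s ! 0) (s ! 1))"
      unfolding J_def
      by (rule def_llI, intro definability_intros def_slD[OF K] dterm_nth_vars dterm_nth_vars[where r = "\<lambda>i. i"]) simp_all
    moreover have "\<exists>a' b'. a' < b' \<and> J a' b' u" if u: "close_to s z u" for u
    proof -
      have "def_s (\<lambda>t. K t u)"
        by (rule def_sI, intro definability_intros def_slD[OF K]) (use close_to_length[OF u] z in simp)
      from interval_split[OF this sz(2)] show ?thesis using neg u unfolding J_def by blast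
    qed
    moreover have "J a2 b2 u" if "J a1 b1 u" "a1 \<le> a2" "b2 \<le> b1" for a1 b1 a2 b2 u
      using that unfolding J_def by (meson order.trans order.strict_trans1 order.strict_trans2)
    ultimately obtain s' z' a' b' where s': "subball s z s' z'" "a' < b'"
      "\<And>u. close_to s' z' u \<Longrightarrow> J a' b' u"
      using uniform_interval[OF gen _ z, of J] by blast
    obtain t where t: "a' < t" "t < b'" using dense_ex s' by blast
    have "length z' = d" "0 < s'" using subball_length[OF s'(1)] z s'(1) by (auto simp: subball_def)
    then obtain u where "close_to s' z' u" "K t u"
      using gen def_f_Cons2[OF g, of t] unfolding generic_cont_def K_def by blast
    then show False using s'(3) t unfolding J_def by blast
  qed
  then obtain u0 a' b' where u0: "close_to s z u0" "a \<le> a'" "a' < b'" "b' \<le> b"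
    "\<And>t. a' < t \<Longrightarrow> t < b' \<Longrightarrow> K t u0" by blast
  have "length u0 = d" using close_to_length[OF u0(1)] z by simp
  have "inc_on (\<lambda>t. g (t # u0)) a' b'"
    using inc[OF u0(1)] u0 unfolding inc_on_def by (meson order.strict_trans1 order.strict_trans2)
  from inc_on_cont1[OF def_f_Cons[OF g \<open>length u0 = d\<close>] u0(3) this]
  obtain t1 where t1: "a' < t1" "t1 < b'" "cont1 (\<lambda>t. g (t # u0)) t1" by blast
  have "cont (Suc d) g (t1 # u0)"
    unfolding cont_def
  proof (intro allI impI)
    fix \<epsilon> :: 'a assume "0 < \<epsilon>"
    then obtain \<eta> where \<eta>: "0 < \<eta>" "\<eta> + \<eta> < \<epsilon>" using half_ex by blast
    obtain u v where uv: "u < t1" "t1 < v" "\<And>y. u < y \<Longrightarrow> y < v \<Longrightarrow> absM (g (t1 # u0) - g (y # u0)) < \<eta>"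
      using t1(3) \<eta>(1) unfolding cont1_def by blast
    \<comment> \<open>A sandwich: the values at \<open>p\<close> and \<open>q\<close> are within
      \<open>\<eta>\<close> of the value at \<open>t1\<close>. Moving \<open>u0\<close> to
      \<open>w\<close> changes them by less than another \<open>\<eta>\<close>, and for
      \<open>t\<close> between \<open>p\<close> and \<open>q\<close> the value at
      \<open>t # w\<close> is trapped between them.\<close>
    obtain p where p: "max u a' < p" "p < t1" using dense_ex[of "max u a'" t1] uv t1 by auto
    obtain q where q: "t1 < q" "q < min v b'" using dense_ex[of t1 "min v b'"] uv t1 by auto
    have pq: "absM (g (t1 # u0) - g (p # u0)) < \<eta>" "absM (g (t1 # u0) - g (q # u0)) < \<eta>"
      by (rule uv(3); use p q uv in auto)+
    have Kpq: "K p u0" "K q u0" by (rule u0(5); use p q t1 in auto)+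
    obtain \<delta>p where \<delta>p: "0 < \<delta>p" "\<And>y. length y = d \<Longrightarrow> close_to \<delta>p u0 y \<Longrightarrow> absM (g (p # u0) - g (p # y)) < \<eta>"
      using Kpq(1) \<eta>(1) unfolding K_def cont_def by blast
    obtain \<delta>q where \<delta>q: "0 < \<delta>q" "\<And>y. length y = d \<Longrightarrow> close_to \<delta>q u0 y \<Longrightarrow> absM (g (q # u0) - g (q # y)) < \<eta>"
      using Kpq(2) \<eta>(1) unfolding K_def cont_def by blast
    obtain \<delta>0 where \<delta>0: "subball s z \<delta>0 u0" using ball_inner[OF u0(1)] by blast
    define \<delta> where "\<delta> = min (min \<delta>p \<delta>q) (min \<delta>0 (min (t1 - p) (q - t1)))"
    have "0 < \<delta>" using \<delta>p \<delta>q \<delta>0 p q unfolding \<delta>_def subball_def by auto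
    moreover have "absM (g (t1 # u0) - g y) < \<epsilon>" if "close_to \<delta> (t1 # u0) y" for y
    proof -
      obtain t w where y: "y = t # w" "absM (t1 - t) < \<delta>" "close_to \<delta> u0 w"
        using \<open>close_to \<delta> (t1 # u0) y\<close> by (rule close_to_ConsE)
      have "length w = d" using close_to_length[OF y(3)] \<open>length u0 = d\<close> by simp
      have "\<delta> \<le> \<delta>p" "\<delta> \<le> \<delta>q" "\<delta> \<le> \<delta>0" unfolding \<delta>_def by (auto intro: min.coboundedI1 min.coboundedI2)
      then have "close_to \<delta>p u0 w" "close_to \<delta>q u0 w" "close_to \<delta>0 u0 w"
        using close_to_mono[OF y(3)] by auto
      then have w: "absM (g (p # u0) - g (p # w)) < \<eta>" "absM (g (q # u0) - g (q # w)) < \<eta>" "close_to s z w"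
        using \<delta>p(2) \<delta>q(2) \<delta>0 \<open>length w = d\<close> unfolding subball_def by blast+
      have "absM (g (t1 # u0) - g (p # w)) < \<epsilon>" "absM (g (t1 # u0) - g (q # w)) < \<epsilon>"
        using absM_triangle[OF pq(1) w(1)] absM_triangle[OF pq(2) w(2)] \<eta>(2) by (meson order.strict_trans)+
      then have bounds: "g (t1 # u0) < g (p # w) + \<epsilon>" "g (q # w) < g (t1 # u0) + \<epsilon>"
        unfolding absM_diff_less_iff by auto
      have "absM (t1 - t) < t1 - p" "absM (t1 - t) < q - t1"
        using y(2) unfolding \<delta>_def by auto
      then have t: "p < t" "t < q" unfolding absM_less_iff by (auto simp: algebra_simps)
      have "a < p" "q < b" using p q u0 by auto
      then have "g (p # w) \<le> g y" "g y \<le> g (q # w)"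
        unfolding y(1) using inc[OF w(3)] t by (meson order.strict_trans)+
      then show ?thesis unfolding absM_diff_less_iff
        using bounds by (meson add_right_mono order.strict_trans1 order.strict_trans2)
    qed
    ultimately show "\<exists>\<delta>>0. \<forall>y. length y = Suc d \<longrightarrow> (close_to \<delta> (t1 # u0) y \<longrightarrow> absM (g (t1 # u0) - g y) < \<epsilon>)"
      by blast
  qed
  moreover have "lo < t1" "t1 < hi" using lohi u0 t1 by auto
  moreover have "close_to r c u0" using u0(1) sz(1) unfolding subball_def by blast
  ultimately show ?thesis by blast
qed

lemma def_f_uminus: "def_f d g \<Longrightarrow> def_f d (\<lambda>u. - g u)"
  unfolding def_f_def using dterm_uminus by blast

text \<open>Every slice is monotone on some interval by \<open>monotone_subinterval\<close>.
  \<open>generic_split\<close> fixes the direction over a whole ball, and the decreasing case passes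
  to \<open>- g\<close>.\<close>

lemma generic_cont_Suc:
  assumes gen: "generic_cont d"
  shows "generic_cont (Suc d)"
  unfolding generic_cont_def
proof (intro allI impI)
  fix g :: "'a list \<Rightarrow> 'a" and c :: "'a list" and r :: 'a
  assume g: "def_f (Suc d) g" and c: "length c = Suc d" and r: "0 < r"
  obtain t0 c' where c': "c = t0 # c'" "length c' = d" using c by (metis length_Suc_conv)
  define A where "A u \<longleftrightarrow> (\<exists>a b. t0 - r \<le> a \<and> a < b \<and> b \<le> t0 + r \<and> inc_on (\<lambda>t. g (t # u)) a b)" for u
  have "def_l d A" unfolding A_def inc_on_def by (rule def_lI, intro definability_intros def_fD[OF g])
  from generic_split[OF gen this c'(2) r] obtain s z where s: "subball r c' s z"
    "(\<forall>y. close_to s z y \<longrightarrow> A y) \<or> (\<forall>y. close_to s z y \<longrightarrow> \<not> A y)" by blast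
  have z: "length z = d" "0 < s" using subball_length[OF s(1)] c' s(1) by (auto simp: subball_def)
  have "t0 - r < t0" "t0 < t0 + r" using r by simp_all
  then have "t0 - r < t0 + r" by (rule order.strict_trans)
  then have mono: "\<exists>a b. t0 - r \<le> a \<and> a < b \<and> b \<le> t0 + r \<and>
      (inc_on (\<lambda>t. g (t # u)) a b \<or> inc_on (\<lambda>t. - g (t # u)) a b)" if "close_to s z u" for u
    using monotone_subinterval[OF def_f_Cons[OF g], of u] close_to_length[OF that] z by simp
  have "\<exists>t u. t0 - r < t \<and> t < t0 + r \<and> close_to s z u \<and> cont (Suc d) g (t # u)"
  proof (cases "\<forall>y. close_to s z y \<longrightarrow> A y")
    case True
    then show ?thesis using generic_cont_Suc_aux[OF gen g z] unfolding A_def by blast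
  next
    case False
    then have "\<exists>a b. t0 - r \<le> a \<and> a < b \<and> b \<le> t0 + r \<and> inc_on (\<lambda>t. - g (t # u)) a b" if "close_to s z u" for u
      using mono[OF that] s(2) that unfolding A_def by blast
    from generic_cont_Suc_aux[OF gen def_f_uminus[OF g] z this]
    obtain t u where "t0 - r < t \<and> t < t0 + r \<and> close_to s z u \<and> cont (Suc d) (\<lambda>u. - g u) (t # u)" by blast
    moreover have "absM (- p - - q) = absM (p - q)" for p q :: 'a
      using absM_minus_commute[of q p] by simp
    ultimately show ?thesis unfolding cont_def by auto
  qed
  then obtain t u where tu: "t0 - r < t" "t < t0 + r" "close_to s z u" "cont (Suc d) g (t # u)" by blast
  then have "close_to r c (t # u)"
    using s(1) unfolding c'(1) close_to_Cons absM_diff_less_iff subball_def by (auto simp: diff_less_eq)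
  then show "\<exists>z. close_to r c z \<and> cont (Suc d) g z" using tu by blast
qed

lemma generic_cont: "generic_cont d"
proof (induction d)
  case 0
  then show ?case unfolding generic_cont_def cont_def using close_to_refl pos_ex by (auto intro!: exI[of _ "[]"])
qed (rule generic_cont_Suc)

end

section \<open>Discontinuities of an equi-continuous family\<close>

lemma close_to_append:
  "length x = length v \<Longrightarrow> close_to d (x @ y) (v @ w) \<longleftrightarrow> close_to d x v \<and> close_to d y w"
  by (induction x v rule: list_induct2) (auto simp: close_to_Cons close_to_def[of _ "[]"] dest: close_to_length)

lemma close_to_coord_proj:
  assumes "close_to d x y" "\<forall>i\<in>set is. i < length x"
  shows "close_to d (coord_proj is x) (coord_proj is y)"
  using assms unfolding close_to_def coord_proj_def by auto

text \<open>Serves to add one coordinate to a projection, whose index list has to stay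
  increasing.\<close>

lemma sorted_insert_split:
  "sorted_wrt (<) xs \<Longrightarrow> (i::nat) \<notin> set xs \<Longrightarrow> \<exists>as bs. xs = as @ bs \<and> sorted_wrt (<) (as @ i # bs)"
proof (induction xs)
  case Nil
  show ?case by (rule exI[of _ "[]"]) auto
next
  case (Cons j xs)
  show ?case
  proof (cases "i < j")
    case True
    then show ?thesis using Cons.prems by (intro exI[of _ "[]"] exI[of _ "j # xs"]) auto
  next
    case False
    then obtain as bs where "xs = as @ bs" "sorted_wrt (<) (as @ i # bs)" using Cons by auto
    then show ?thesis using False Cons.prems by (intro exI[of _ "j # as"] exI[of _ bs]) auto
  qed
qed

text \<open>Bounds the candidates, so that \<open>GREATEST\<close> in \<open>dim\<close> is a true
  maximum once a witness exists.\<close>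

lemma dim_witness_le: "dim_witness n X d \<Longrightarrow> d \<le> n"
proof -
  assume "dim_witness n X d"
  then obtain "is" where i: "length is = d" "sorted_wrt (<) is" "\<forall>i\<in>set is. i < n"
    unfolding dim_witness_def by blast
  then have "card (set is) = d" using distinct_card strict_sorted_iff by metis
  moreover have "card (set is) \<le> card {..<n}" using i by (intro card_mono) auto
  ultimately show ?thesis by simp
qed

context tame_structure begin

lemma germ_left:
  assumes A: "def_s A"
  shows "(\<exists>v<a. \<forall>x. v < x \<and> x < a \<longrightarrow> A x) \<or> (\<exists>v<a. \<forall>x. v < x \<and> x < a \<longrightarrow> \<not> A x)"
proof -
  have "def_s (\<lambda>x. A (- x))" by (intro def_sI def_sD[OF A] definability_intros)
  then obtain v where v: "- a < v"
    "(\<forall>x. - a < x \<and> x < v \<longrightarrow> A (- x)) \<or> (\<forall>x. - a < x \<and> x < v \<longrightarrow> \<not> A (- x))"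
    using germ_right[of "\<lambda>x. A (- x)" "- a"] by blast
  have "- v < a" using v(1) by (simp add: minus_less_iff)
  moreover have "- a < - x \<and> - x < v" if "- v < x" "x < a" for x
    using that by (simp add: minus_less_iff)
  ultimately show ?thesis using v(2) by (metis minus_minus)
qed

text \<open>\<open>uniform_interval\<close> gives a common interval of \<open>i\<close>-th
  coordinates over a smaller ball, hence a box in the projection to \<open>is\<close> together with
  \<open>i\<close>. The index \<open>i\<close> is new: a coordinate from \<open>is\<close> is
  determined by \<open>u\<close>, whereas this one varies.\<close>

lemma dim_witness_Suc:
  assumes P: "definable F R n P"
    and "is": "sorted_wrt (<) is" "\<forall>j\<in>set is. j < n" "length is = d" and "i < n"
    and c: "length c = d" "0 < r"
    and ex: "\<And>u. close_to r c u \<Longrightarrow> \<exists>a b. a < b \<and>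
      (\<forall>t. a < t \<and> t < b \<longrightarrow> (\<exists>q. length q = n \<and> q \<in> P \<and> coord_proj is q = u \<and> q ! i = t))"
  shows "dim_witness n P (Suc d)"
proof -
  define I where "I a b u \<longleftrightarrow>
    (\<forall>t. a < t \<and> t < b \<longrightarrow> (\<exists>q. length q = n \<and> q \<in> P \<and> coord_proj is q = u \<and> q ! i = t))" for a b u
  have "def_ll 2 d (\<lambda>s. I (s ! 0) (s ! 1))"
    unfolding I_def
    by (rule def_llI, intro definability_intros definable_imp_dpred[OF P] dterm_nth_vars dterm_nth_vars[where r = "\<lambda>i. i"])
      (use \<open>i < n\<close> "is" in \<open>auto intro!: dtuple_coord_proj[of _ n] dtuple_intros\<close>)
  moreover have "I a' b' u" if "I a b u" "a \<le> a'" "b' \<le> b" for a b a' b' u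
    using that unfolding I_def by (meson order.strict_trans1 order.strict_trans2)
  moreover have "\<exists>a b. a < b \<and> I a b u" if "close_to r c u" for u
    using ex[OF that] unfolding I_def by blast
  ultimately obtain s z a b where sz: "subball r c s z" "a < b" "\<And>u. close_to s z u \<Longrightarrow> I a b u"
    using uniform_interval[OF generic_cont _ c, of I] by blast
  have z: "length z = d" "0 < s" using subball_length[OF sz(1)] c sz(1) by (auto simp: subball_def)
  have fib: "\<exists>q\<in>P. coord_proj is q = u \<and> q ! i = t" if "close_to s z u" "a < t" "t < b" for u t
    using sz(3)[OF that(1)] that unfolding I_def by blast
  obtain t0 where t0: "a < t0" "t0 < b" using dense_ex sz by blast
  obtain t1 where t1: "t0 < t1" "t1 < b" using dense_ex t0 by blast
  have "i \<notin> set is"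
  proof
    assume "i \<in> set is"
    then obtain j where j: "j < d" "is ! j = i" using "is"(3) by (auto simp: in_set_conv_nth)
    have "t = z ! j" if t: "a < t" "t < b" for t
    proof -
      obtain q where "coord_proj is q = z" "q ! i = t" using fib[OF close_to_refl[OF z(2)] t] by blast
      then show ?thesis using j "is"(3) unfolding coord_proj_def by auto
    qed
    then have "t0 = t1" using t0 t1 by (metis order.strict_trans)
    then show False using t1 by simp
  qed
  then obtain as bs where ab: "is = as @ bs" "sorted_wrt (<) (as @ i # bs)"
    using sorted_insert_split[OF "is"(1)] by blast
  \<comment> \<open>The centre is cut at the place where \<open>i\<close> enters the index list, and
    \<open>t0\<close> is inserted there.\<close>
  define z1 z2 where "z1 = take (length as) z" and "z2 = drop (length as) z"
  have z12: "z = z1 @ z2" "length z1 = length as" using z "is"(3) ab by (auto simp: z1_def z2_def)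
  define \<delta> where "\<delta> = min s (min (t0 - a) (b - t0))"
  have \<delta>: "0 < \<delta>" "\<delta> \<le> s" using z t0 unfolding \<delta>_def by auto
  have ball: "w \<in> coord_proj (as @ i # bs) ` P" if w: "close_to \<delta> (z1 @ t0 # z2) w" for w
  proof -
    define w1 where "w1 = take (length z1) w"
    have len: "length w = Suc (length z1 + length z2)" using close_to_length[OF w] by simp
    then obtain t w2 where w12: "w = w1 @ t # w2"
      unfolding w1_def by (metis id_take_nth_drop less_Suc_eq_le le_add1)
    have lw: "length z1 = length w1" using len by (simp add: w1_def)
    have c1: "close_to \<delta> z1 w1" "absM (t0 - t) < \<delta>" "close_to \<delta> z2 w2"
      using w unfolding w12 close_to_append[OF lw] close_to_Cons by auto
    have "close_to \<delta> z (w1 @ w2)" unfolding z12(1) close_to_append[OF lw] using c1 by simp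
    then have "close_to s z (w1 @ w2)" using close_to_mono \<delta> by blast
    moreover have "absM (t0 - t) < t0 - a" "absM (t0 - t) < b - t0" using c1(2) unfolding \<delta>_def by auto
    then have "a < t" "t < b" unfolding absM_less_iff by (auto simp: algebra_simps)
    ultimately obtain q where q: "q \<in> P" "coord_proj is q = w1 @ w2" "q ! i = t" using fib by blast
    then have "coord_proj (as @ i # bs) q = w"
      using lw z12(2) unfolding ab(1) coord_proj_def w12 by simp
    then show ?thesis using q by blast
  qed
  then have "has_interior (coord_proj (as @ i # bs) ` P)"
    unfolding has_interior_def using \<delta>(1) close_to_refl by blast
  moreover have "length (as @ i # bs) = Suc d" "\<forall>j\<in>set (as @ i # bs). j < n"
    using "is" ab \<open>i < n\<close> by auto
  ultimately show ?thesis unfolding dim_witness_def using ab(2) by blast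
qed

text \<open>Formulated with witnesses, so that it can be applied to the largest \<open>d\<close>.
  The absence of a witness \<open>Suc d\<close> for \<open>P\<close> is what makes the fibres of
  \<open>P\<close> over some ball discrete.\<close>

lemma discontinuity_dim:
  assumes C: "C \<subseteq> {x. length x = m}" "definable F R m C"
    and P: "P \<subseteq> {q. length q = n}" "definable F R n P"
    and f: "definable_fun F R m n C P f"
    and equi: "equicontinuous_wrt C P f"
    and wit: "dim_witness n (snd ` {(x, q). x \<in> C \<and> q \<in> P \<and> \<not> continuous_at_CP C P f x q}) d"
  shows "dim_witness n P (Suc d)"
proof (rule ccontr)
  assume neg: "\<not> ?thesis"
  define Z where "Z = snd ` {(x, q). x \<in> C \<and> q \<in> P \<and> \<not> continuous_at_CP C P f x q}"
  obtain "is" y r where "is": "length is = d" "sorted_wrt (<) is" "\<forall>i\<in>set is. i < n"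
    and y: "y \<in> coord_proj is ` Z" "0 < r" "\<And>u. close_to r y u \<Longrightarrow> u \<in> coord_proj is ` Z"
    using wit unfolding dim_witness_def has_interior_def Z_def by blast
  have "length y = d" using y(1) "is"(1) unfolding coord_proj_def by auto
  define X where "X i t u \<longleftrightarrow> (\<exists>q. length q = n \<and> q \<in> P \<and> coord_proj is q = u \<and> q ! i = t)" for i t u
  have X: "def_sl d (X i)" if "i < n" for i
    unfolding X_def
    by (rule def_slI, intro definability_intros definable_imp_dpred[OF P(2)] dterm_nth_vars[where r = "\<lambda>i. i"])
      (use that "is" in \<open>auto intro!: dtuple_coord_proj[of _ n] dtuple_intros\<close>)
  define B where "B i u \<longleftrightarrow> (\<exists>a b. a < b \<and> (\<forall>t. a < t \<and> t < b \<longrightarrow> X i t u))" for i u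
  \<comment> \<open>One coordinate at a time: \<open>B k\<close> cannot hold on a whole ball, by
    \<open>dim_witness_Suc\<close> and \<open>neg\<close>, so by \<open>generic_split\<close> it
    fails throughout a smaller one.\<close>
  have "\<exists>s z. subball r y s z \<and> (\<forall>j<k. \<forall>u. close_to s z u \<longrightarrow> \<not> B j u)" if "k \<le> n" for k
    using that
  proof (induction k)
    case 0
    then show ?case using y(2) unfolding subball_def by blast
  next
    case (Suc k)
    then obtain s z where sz: "subball r y s z" "\<forall>j<k. \<forall>u. close_to s z u \<longrightarrow> \<not> B j u" by auto
    have z: "length z = d" "0 < s"
      using subball_length[OF sz(1)] \<open>length y = d\<close> sz(1) by (auto simp: subball_def)
    have "def_l d (B k)" unfolding B_def by (rule def_lI, intro definability_intros def_slD[OF X]) (use Suc in auto)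
    from generic_split[OF generic_cont this z] obtain s' z' where s': "subball s z s' z'"
      "(\<forall>y. close_to s' z' y \<longrightarrow> B k y) \<or> (\<forall>y. close_to s' z' y \<longrightarrow> \<not> B k y)" by blast
    have z': "length z' = d" "0 < s'" using subball_length[OF s'(1)] z s'(1) by (auto simp: subball_def)
    have "\<not> (\<forall>y. close_to s' z' y \<longrightarrow> B k y)"
    proof
      assume all: "\<forall>y. close_to s' z' y \<longrightarrow> B k y"
      have "k < n" using Suc.prems by simp
      from dim_witness_Suc[OF P(2) "is"(2,3,1) this z'] show False
        using all neg unfolding B_def X_def by blast
    qed
    then have "\<forall>j<Suc k. \<forall>u. close_to s' z' u \<longrightarrow> \<not> B j u"
      using s' sz(2) unfolding subball_def less_Suc_eq by blast
    then show ?case using subball_trans[OF sz(1) s'(1)] by blast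
  qed
  from this[of n] obtain s z where sz: "subball r y s z" "\<And>j u. j < n \<Longrightarrow> close_to s z u \<Longrightarrow> \<not> B j u"
    by blast
  have z: "length z = d" "0 < s"
    using subball_length[OF sz(1)] \<open>length y = d\<close> sz(1) by (auto simp: subball_def)

  \<comment> \<open>The \<open>j\<close>-th coordinates of the fibre contain no interval, so both
    one-sided germs at \<open>q ! j\<close> are empty. The least of the resulting radii over all
    \<open>j\<close> isolates \<open>q\<close>.\<close>
  have isolated: "\<exists>\<rho>>0. \<forall>q'. length q' = n \<longrightarrow> q' \<in> P \<and> coord_proj is q' = u \<and> close_to \<rho> q q' \<longrightarrow> q' = q"
    if u: "close_to s z u" and q: "q \<in> P" "coord_proj is q = u" for u q
  proof -
    have lu: "length u = d" using close_to_length[OF u] z by simp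
    have "\<exists>\<rho>>0. \<forall>q'. close_to \<rho> q q' \<longrightarrow> (q' \<in> P \<and> coord_proj is q' = u \<longrightarrow> q' ! j = q ! j)"
      if j: "j \<in> set [0..<n]" for j
    proof -
      have "j < n" using j by simp
      have Xs: "def_s (\<lambda>t. X j t u)" by (rule def_sI, intro definability_intros def_slD[OF X[OF \<open>j < n\<close>]] lu)
      have nB: "\<not> B j u" using sz(2)[OF \<open>j < n\<close> u] .
      obtain v where v: "q ! j < v" "\<And>t. q ! j < t \<Longrightarrow> t < v \<Longrightarrow> \<not> X j t u"
        using germ_right[OF Xs, of "q ! j"] nB unfolding B_def by blast
      obtain w where w: "w < q ! j" "\<And>t. w < t \<Longrightarrow> t < q ! j \<Longrightarrow> \<not> X j t u"
        using germ_left[OF Xs, of "q ! j"] nB unfolding B_def by blast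
      define \<rho> where "\<rho> = min (v - q ! j) (q ! j - w)"
      have "q' ! j = q ! j" if q': "close_to \<rho> q q'" "q' \<in> P" "coord_proj is q' = u" for q'
      proof (rule ccontr)
        assume ne: "q' ! j \<noteq> q ! j"
        have len: "length q = n" "length q' = n" using P(1) q q' by auto
        have "X j (q' ! j) u" unfolding X_def using q' len by blast
        have "absM (q ! j - q' ! j) < \<rho>" using q'(1) len \<open>j < n\<close> unfolding close_to_def by simp
        then have "absM (q ! j - q' ! j) < v - q ! j" "absM (q ! j - q' ! j) < q ! j - w" unfolding \<rho>_def by auto
        then have "q' ! j < v" "w < q' ! j" unfolding absM_less_iff by (auto simp: algebra_simps)
        then show False using v(2) w(2) \<open>X j (q' ! j) u\<close> ne by (metis linorder_neqE)
      qed
      moreover have "0 < \<rho>" using v w unfolding \<rho>_def by simp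
      ultimately show ?thesis by blast
    qed
    from finite_min_radius[of "[0..<n]" q "\<lambda>j q'. q' \<in> P \<and> coord_proj is q' = u \<longrightarrow> q' ! j = q ! j", OF this]
    obtain \<rho> where \<rho>: "0 < \<rho>" "\<And>q' j. close_to \<rho> q q' \<Longrightarrow> j < n \<Longrightarrow> q' \<in> P \<Longrightarrow> coord_proj is q' = u \<Longrightarrow> q' ! j = q ! j"
      by auto
    have "q' = q" if "q' \<in> P" "coord_proj is q' = u" "close_to \<rho> q q'" for q'
      using P(1) q(1) that \<rho>(2) by (intro nth_equalityI) auto
    then show ?thesis using \<rho>(1) by blast
  qed

  \<comment> \<open>Only the graph of \<open>f\<close> over \<open>C\<close> and \<open>P\<close> is
    definable; a total definable \<open>g\<close> extending \<open>f\<close> can be substituted into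
    formulas.\<close>
  have "\<exists>g. def_f (m + n) g \<and> (\<forall>x\<in>C. \<forall>q\<in>P. g (x @ q) = f x q)"
  proof -
    define G where "G v w \<longleftrightarrow> w @ [v] \<in> {x @ q @ [f x q] | x q. x \<in> C \<and> q \<in> P}" for v w
    have G_f: "v = f x q" if xq: "G v (x @ q)" "x \<in> C" "q \<in> P" for v x q
    proof -
      obtain x' q' where "(x @ q) @ [v] = x' @ q' @ [f x' q']" "x' \<in> C" "q' \<in> P"
        using xq(1) unfolding G_def by blast
      moreover have "length x = length x'" using C(1) xq calculation by auto
      ultimately show ?thesis by simp
    qed
    have "def_sl (m + n) G"
      unfolding G_def
      by (rule def_slI, rule definable_imp_dpred[OF f[unfolded definable_fun_def]], rule dtuple_append)
        (use dtuple_Cons[OF dterm_var dtuple_Nil, of 0] dtuple_vars in auto)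
    moreover have "v = v'" if vv: "G v w" "G v' w" for v v' w
    proof -
      obtain x q where "w = x @ q" "x \<in> C" "q \<in> P" using vv(1) unfolding G_def by auto
      then show ?thesis using G_f vv by metis
    qed
    ultimately obtain g where g: "def_f (m + n) g" "\<And>w. (\<exists>v. G v w) \<Longrightarrow> G (g w) w"
      using unique_fun[of "m + n" G] by blast
    have "g (x @ q) = f x q" if "x \<in> C" "q \<in> P" for x q
    proof (rule G_f[OF g(2)])
      show "\<exists>v. G v (x @ q)" unfolding G_def using that by auto
    qed (use that in auto)
    then show ?thesis using g(1) by blast
  qed
  then obtain g where g: "def_f (m + n) g" "\<And>x q. x \<in> C \<Longrightarrow> q \<in> P \<Longrightarrow> g (x @ q) = f x q" by blast
  \<comment> \<open>Continuity at \<open>(x, q)\<close>, rewritten with \<open>g\<close> and with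
    length guards so that its definability can be read off.\<close>
  define E where "E x q \<longleftrightarrow> (\<forall>\<epsilon>>0. \<exists>\<delta>>0. \<forall>x'. length x' = m \<longrightarrow> (\<forall>q'. length q' = n \<longrightarrow>
    x' \<in> C \<and> q' \<in> P \<and> close_to \<delta> x x' \<and> close_to \<delta> q q' \<longrightarrow> absM (g (x @ q) - g (x' @ q')) < \<epsilon>))" for x q
  have defE: "def_ll m n E"
    unfolding E_def
    by (rule def_llI, intro definability_intros definable_imp_dpred[OF P(2)] definable_imp_dpred[OF C(2)] def_fD[OF g(1)])
      (rule dtuple_intros)+
  have E: "continuous_at_CP C P f x q" if xq: "E x q" "x \<in> C" "q \<in> P" for x q
    unfolding continuous_at_CP_def
  proof (intro allI impI)
    fix \<epsilon> :: 'a assume "0 < \<epsilon>"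
    then obtain \<delta> where \<delta>: "0 < \<delta>" "\<And>x' q'. length x' = m \<Longrightarrow> length q' = n \<Longrightarrow>
      x' \<in> C \<and> q' \<in> P \<and> close_to \<delta> x x' \<and> close_to \<delta> q q' \<Longrightarrow> absM (g (x @ q) - g (x' @ q')) < \<epsilon>"
      using xq(1) unfolding E_def by blast
    have "absM (f x q - f x' q') < \<epsilon>" if "x' \<in> C" "q' \<in> P" "close_to \<delta> x x' \<and> close_to \<delta> q q'" for x' q'
      using \<delta>(2)[of x' q'] that g(2) xq(2,3) C(1) P(1) by auto
    then show "\<exists>\<delta>>0. \<forall>x'\<in>C. \<forall>q'\<in>P. close_to \<delta> x x' \<and> close_to \<delta> q q' \<longrightarrow> absM (f x q - f x' q') < \<epsilon>"
      using \<delta>(1) by blast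
  qed
  have E': "E x q" if xq: "continuous_at_CP C P f x q" "x \<in> C" "q \<in> P" for x q
    unfolding E_def
  proof (intro allI impI)
    fix \<epsilon> :: 'a assume "0 < \<epsilon>"
    then obtain \<delta> where \<delta>: "0 < \<delta>" "\<And>x' q'. x' \<in> C \<Longrightarrow> q' \<in> P \<Longrightarrow>
      close_to \<delta> x x' \<and> close_to \<delta> q q' \<Longrightarrow> absM (f x q - f x' q') < \<epsilon>"
      using xq(1) unfolding continuous_at_CP_def by blast
    show "\<exists>\<delta>>0. \<forall>x'. length x' = m \<longrightarrow> (\<forall>q'. length q' = n \<longrightarrow>
    x' \<in> C \<and> q' \<in> P \<and> close_to \<delta> x x' \<and> close_to \<delta> q q' \<longrightarrow> absM (g (x @ q) - g (x' @ q')) < \<epsilon>)"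
      using \<delta> g(2) xq(2,3) by (intro exI[of _ \<delta>]) auto
  qed

  \<comment> \<open>The isolating radius and the value are entries of the tuple, so that closeness
    of tuples keeps the radius from collapsing and controls the change of value.\<close>
  define S where "S t u \<longleftrightarrow> (\<exists>x. length x = m \<and> (\<exists>q. length q = n \<and> (\<exists>\<rho> v. t = \<rho> # v # x @ q \<and> 0 < \<rho> \<and>
    x \<in> C \<and> q \<in> P \<and> coord_proj is q = u \<and> v = g (x @ q) \<and> \<not> E x q \<and>
    (\<forall>q'. length q' = n \<longrightarrow> q' \<in> P \<and> coord_proj is q' = u \<and> close_to \<rho> q q' \<longrightarrow> q' = q))))" for t u
  have proj: "dtuple d (\<lambda>e. coord_proj is (l e))" if "dtuple n l" for l
    using dtuple_coord_proj[of "is" n d l] "is" that by blast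
  have "def_ll (Suc (Suc (m + n))) d S"
    unfolding S_def
    by (rule def_llI, intro definability_intros definable_imp_dpred[OF P(2)] definable_imp_dpred[OF C(2)] def_fD[OF g(1)]
        def_llD[OF defE])
      (rule dtuple_intros dterm_var proj)+
  moreover have "\<exists>t. length t = Suc (Suc (m + n)) \<and> S t u" if u: "close_to s z u" for u
  proof -
    have "close_to r y u" using sz(1) u unfolding subball_def by blast
    then obtain q where "q \<in> Z" "coord_proj is q = u" using y(3) by blast
    then obtain x where xq: "x \<in> C" "q \<in> P" "\<not> continuous_at_CP C P f x q" unfolding Z_def by auto
    obtain \<rho> where \<rho>: "0 < \<rho>"
      "\<forall>q'. length q' = n \<longrightarrow> q' \<in> P \<and> coord_proj is q' = u \<and> close_to \<rho> q q' \<longrightarrow> q' = q"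
      using isolated[OF u \<open>q \<in> P\<close> \<open>coord_proj is q = u\<close>] by blast
    have len: "length x = m" "length q = n" using xq C(1) P(1) by auto
    have "S (\<rho> # g (x @ q) # x @ q) u"
      unfolding S_def using E[OF _ xq(1,2)] xq \<rho> len \<open>coord_proj is q = u\<close>
      by (intro exI[of _ x] conjI exI[of _ q] exI[of _ \<rho>] exI[of _ "g (x @ q)"]) auto
    then show ?thesis using len by (intro exI[of _ "\<rho> # g (x @ q) # x @ q"]) simp
  qed
  ultimately obtain u0 t0 where t0: "close_to s z u0" "S t0 u0"
    "\<And>\<epsilon>. 0 < \<epsilon> \<Longrightarrow> \<exists>\<delta>. subball s z \<delta> u0 \<and> (\<forall>u. close_to \<delta> u0 u \<longrightarrow> (\<exists>t. S t u \<and> close_to \<epsilon> t0 t))"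
    using lsc_point[OF generic_cont _ z, of "Suc (Suc (m + n))" S] by blast
  obtain x0 q0 \<rho>0 v0 where 0: "length x0 = m" "length q0 = n" "t0 = \<rho>0 # v0 # x0 @ q0" "0 < \<rho>0" "x0 \<in> C" "q0 \<in> P"
    "coord_proj is q0 = u0" "v0 = g (x0 @ q0)" "\<not> E x0 q0"
    using t0(2) unfolding S_def by blast

  have "continuous_at_CP C P f x0 q0"
    unfolding continuous_at_CP_def
  proof (intro allI impI)
    fix \<epsilon> :: 'a assume "0 < \<epsilon>"
    \<comment> \<open>Three errors of size \<open>\<eta>\<close> occur: from \<open>f x0 q0\<close>
      to \<open>f x q'\<close>, on to \<open>f x0 q'\<close>, and on to \<open>f x' q'\<close>. The
      first two add up to less than \<open>\<eta>1\<close>.\<close>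
    then obtain \<eta>1 where \<eta>1: "0 < \<eta>1" "\<eta>1 + \<eta>1 < \<epsilon>" using half_ex by blast
    then obtain \<eta> where \<eta>: "0 < \<eta>" "\<eta> + \<eta> < \<eta>1" using half_ex by blast
    obtain \<delta>1 where \<delta>1: "0 < \<delta>1" "\<And>p x'. p \<in> P \<Longrightarrow> x' \<in> C \<Longrightarrow> close_to \<delta>1 x0 x' \<Longrightarrow> absM (f x0 p - f x' p) < \<eta>"
      using equi \<eta>(1) 0(5) unfolding equicontinuous_wrt_def by blast
    obtain h where h: "0 < h" "h + h < \<rho>0" using half_ex 0(4) by blast
    define k where "k = min h (min \<delta>1 \<eta>)"
    have "0 < k" using h \<delta>1 \<eta> unfolding k_def by simp
    \<comment> \<open>Three displacements by \<open>\<kappa>\<close> must fit below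
      \<open>\<rho>0\<close>: two between \<open>q\<close> and \<open>q'\<close> and one for the
      change of radius. Indeed
      \<open>(\<kappa> + \<kappa>) + \<kappa> < h + h < \<rho>0\<close>.\<close>
    then obtain \<kappa> where \<kappa>: "0 < \<kappa>" "\<kappa> + \<kappa> < k" using half_ex by blast
    have k: "\<kappa> + \<kappa> < h" "\<kappa> < h" "\<kappa> \<le> \<delta>1" "\<kappa> \<le> \<eta>"
    proof -
      have "\<kappa> < \<kappa> + \<kappa>" using \<kappa> by simp
      then have "\<kappa> < k" using \<kappa>(2) by (rule order.strict_trans)
      then show "\<kappa> + \<kappa> < h" "\<kappa> < h" "\<kappa> \<le> \<delta>1" "\<kappa> \<le> \<eta>" using \<kappa>(2) unfolding k_def by auto
    qed
    obtain \<delta>2 where \<delta>2: "subball s z \<delta>2 u0" "\<And>u. close_to \<delta>2 u0 u \<Longrightarrow> \<exists>t. S t u \<and> close_to \<kappa> t0 t"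
      using t0(3)[OF \<kappa>(1)] by blast
    define \<delta> where "\<delta> = min \<kappa> (min \<delta>1 \<delta>2)"
    have "0 < \<delta>" using \<kappa> \<delta>1 \<delta>2(1) unfolding \<delta>_def subball_def by auto
    have \<delta>le: "\<delta> \<le> \<kappa>" "\<delta> \<le> \<delta>1" "\<delta> \<le> \<delta>2" unfolding \<delta>_def by (auto intro: min.coboundedI1 min.coboundedI2)
    moreover have "absM (f x0 q0 - f x' q') < \<epsilon>"
      if xq': "x' \<in> C" "q' \<in> P" "close_to \<delta> x0 x'" "close_to \<delta> q0 q'" for x' q'
    proof -
      \<comment> \<open>Lower semicontinuity is applied over the projection of \<open>q'\<close>
        itself, so the nearby tuple contains a point \<open>q\<close> of the same fibre as
        \<open>q'\<close>.\<close>
      have "close_to \<delta>2 u0 (coord_proj is q')"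
        unfolding 0(7)[symmetric]
        by (rule close_to_mono[OF close_to_coord_proj[OF xq'(4)] \<delta>le(3)]) (use "is" 0 in auto)
      then obtain t where t: "S t (coord_proj is q')" "close_to \<kappa> t0 t" using \<delta>2(2) by blast
      obtain x q \<rho> v where 1: "length x = m" "length q = n" "t = \<rho> # v # x @ q" "x \<in> C" "q \<in> P"
        "v = g (x @ q)"
        "\<And>q''. length q'' = n \<Longrightarrow> q'' \<in> P \<and> coord_proj is q'' = coord_proj is q' \<and> close_to \<rho> q q'' \<Longrightarrow> q'' = q"
        using t(1) unfolding S_def by blast
      have cl: "absM (\<rho>0 - \<rho>) < \<kappa>" "absM (v0 - v) < \<kappa>" "close_to \<kappa> x0 x" "close_to \<kappa> q0 q"
        using t(2) 0(1) 1(1) unfolding 0(3) 1(3) by (auto simp: close_to_Cons close_to_append)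
      \<comment> \<open>Both \<open>q\<close> and \<open>q'\<close> are near \<open>q0\<close>. Once
        \<open>q'\<close> is within the radius \<open>\<rho>\<close> that isolates \<open>q\<close>
        in their common fibre, the two coincide.\<close>
      have "close_to (\<kappa> + \<kappa>) q q'"
        using close_to_triangle[OF close_to_sym[OF cl(4)] close_to_mono[OF xq'(4) \<delta>le(1)]] .
      moreover have "\<kappa> + \<kappa> \<le> \<rho>"
      proof -
        have "(\<kappa> + \<kappa>) + \<kappa> < h + h" using k by (intro add_strict_mono)
        also have "\<dots> < \<rho>0" by (rule h)
        also have "\<dots> < \<rho> + \<kappa>" using cl(1) unfolding absM_diff_less_iff by blast
        finally show ?thesis by simp
      qed
      ultimately have "close_to \<rho> q q'" by (rule close_to_mono)
      moreover have "length q' = n" using P(1) xq' by auto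
      ultimately have q: "q' = q" using 1(7)[of q'] xq' by blast
      \<comment> \<open>These are the value entries \<open>v0\<close> and \<open>v\<close> of the
        two tuples, since \<open>q = q'\<close>. Equi-continuity at \<open>x0\<close> then removes
        the uncontrolled point \<open>x\<close>.\<close>
      have "absM (f x0 q0 - f x q') < \<eta>"
        using cl(2) k(4) 0 1 g(2) unfolding q by simp
      moreover have "absM (f x q' - f x0 q') < \<eta>"
        using \<delta>1(2)[OF xq'(2) 1(4) close_to_mono[OF cl(3) k(3)]] absM_minus_commute by metis
      ultimately have "absM (f x0 q0 - f x0 q') < \<eta>1"
        using absM_triangle \<eta>(2) by (meson order.strict_trans)
      moreover have "absM (f x0 q' - f x' q') < \<eta>"
        using \<delta>1(2)[OF xq'(2,1) close_to_mono[OF xq'(3) \<delta>le(2)]] .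
      ultimately have "absM (f x0 q0 - f x' q') < \<eta>1 + \<eta>" by (rule absM_triangle)
      also have "\<eta> < \<eta>1" using \<eta> by (metis less_add_same_cancel1 order.strict_trans)
      then have "\<eta>1 + \<eta> < \<epsilon>" using \<eta>1(2) by (meson add_strict_left_mono order.strict_trans)
      finally show ?thesis .
    qed
    ultimately show "\<exists>\<delta>>0. \<forall>x'\<in>C. \<forall>q'\<in>P. close_to \<delta> x0 x' \<and> close_to \<delta> q0 q' \<longrightarrow> absM (f x0 q0 - f x' q') < \<epsilon>"
      using \<open>0 < \<delta>\<close> by blast
  qed
  then show False using E' 0 by blast
qed

end

text \<open>Without positive elements there is no \<open>\<epsilon>\<close> to violate. If some
  positive \<open>a\<close> has no positive element below it, a ball of radius \<open>a\<close> is a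
  single point, and every function is continuous.\<close>

lemma discontinuous_imp_dense:
  fixes f :: "'a list \<Rightarrow> 'a list \<Rightarrow> 'a::linordered_ab_group_add"
  assumes "\<not> continuous_at_CP C P f x q"
  shows "\<exists>a::'a. 0 < a"
    and "\<And>a::'a. 0 < a \<Longrightarrow> \<exists>b. 0 < b \<and> b < a"
proof -
  obtain \<epsilon> :: 'a where \<epsilon>: "0 < \<epsilon>" "\<And>\<delta>. 0 < \<delta> \<Longrightarrow> \<exists>x'\<in>C. \<exists>q'\<in>P. close_to \<delta> x x' \<and> close_to \<delta> q q' \<and>
     \<not> absM (f x q - f x' q') < \<epsilon>"
    using assms unfolding continuous_at_CP_def by blast
  then show "\<exists>a::'a. 0 < a" by blast
  fix a :: 'a assume a: "0 < a"
  show "\<exists>b. 0 < b \<and> b < a"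
  proof (rule ccontr)
    assume no: "\<not> ?thesis"
    have zero: "s = t" if "absM (s - t) < a" for s t :: 'a
    proof (rule ccontr)
      assume "s \<noteq> t"
      then have "absM (s - t) \<noteq> 0" unfolding absM_def max_def by auto
      then have "0 < absM (s - t)" using absM_nonneg[of "s - t"] by simp
      then show False using no that by blast
    qed
    have eq: "y = z" if "close_to a y z" for y z :: "'a list"
      using that zero unfolding close_to_def by (auto intro: nth_equalityI)
    obtain x' q' where *: "close_to a x x'" "close_to a q q'" "\<not> absM (f x q - f x' q') < \<epsilon>" using \<epsilon>(2)[OF a] by blast
    then have "x' = x" "q' = q" using eq by auto
    then show False using * \<epsilon>(1) by simp
  qed
qed

theorem mainTheorem2:
  fixes F :: "'f \<Rightarrow> 'a::linordered_ab_group_add list \<Rightarrow> 'a"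
    and R :: "'r \<Rightarrow> 'a list \<Rightarrow> bool"
    and m n :: nat
    and C P :: "'a list set"
    and f :: "'a list \<Rightarrow> 'a list \<Rightarrow> 'a"
  assumes "definably_complete F R"
    and "locally_o_minimal F R"
    and "C \<subseteq> {x. length x = m}" and "definable F R m C" and "closed_in_M m C"
    and "P \<subseteq> {q. length q = n}" and "definable F R n P" and "P \<noteq> {}"
    and "definable_fun F R m n C P f"
    and "equicontinuous_wrt C P f"
  shows "dim n (snd ` {(x, q). x \<in> C \<and> q \<in> P \<and> \<not> continuous_at_CP C P f x q}) < dim n P"
proof (cases "snd ` {(x, q). x \<in> C \<and> q \<in> P \<and> \<not> continuous_at_CP C P f x q} = {}")
  case True
  then show ?thesis using \<open>P \<noteq> {}\<close> unfolding dim_def by simp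
next
  case False
  define Z where "Z = snd ` {(x, q). x \<in> C \<and> q \<in> P \<and> \<not> continuous_at_CP C P f x q}"
  obtain x q where xq: "\<not> continuous_at_CP C P f x q" using False by auto
  interpret tame_structure F R
    using assms(1,2) discontinuous_imp_dense[OF xq] by unfold_locales
  \<comment> \<open>The projection to the one-point space M^0 supplies a first witness, so that the
    maximum over \<open>d\<close> is attained.\<close>
  have "dim_witness n Z 0"
  proof -
    obtain \<delta> :: 'a where "0 < \<delta>" using pos_ex by blast
    moreover have "coord_proj [] ` Z = {[]}" using False unfolding Z_def coord_proj_def by auto
    ultimately have "has_interior (coord_proj [] ` Z)" unfolding has_interior_def close_to_def by auto
    then show ?thesis unfolding dim_witness_def by (intro exI[of _ "[]"]) simp
  qed
  then have "dim_witness n Z (GREATEST d. dim_witness n Z d)"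
    using dim_witness_le by (rule GreatestI_nat)
  then have "dim_witness n P (Suc (GREATEST d. dim_witness n Z d))"
    using discontinuity_dim[OF assms(3,4,6,7,9,10)] unfolding Z_def by blast
  then have "Suc (GREATEST d. dim_witness n Z d) \<le> (GREATEST d. dim_witness n P d)"
    using dim_witness_le by (rule Greatest_le_nat)
  then show ?thesis using False \<open>P \<noteq> {}\<close> unfolding dim_def Z_def by simp
qed

end
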